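(* Let $\mathcal{N}$ be a series-parallel LCR network that involves only two types of components (that is, all of its base elements are inductors and capacitors, or all are inductors and resistors, or all are capacitors and resistors). Then $\mathcal{N}$ is locally identifiable if and only if the constitutive equation of $\mathcal{N}$ has as many non-monic coefficients as there are parameters.
   Context: A series-parallel LCR network is built from base elements (resistors, inductors, capacitors) by finitely many series combinations ($\wedge$) and parallel combinations ($\vee$). Each base element carries its own parameter: a resistance $R$, an inductance $L$, or an inverse capacitance $C$; parameters of distinct base elements are independent, so the number of parameters $n$ equals the number of base elements. The constitutive equation of a network is a linear differential equation $f_1V=f_2I$ relating the voltage $V$ and the current $I$, where $f_1,f_2$ are polynomials in $\frac{d}{dt}$ whose coefficients are polynomials in the parameters. It is obtained recursively (without cancelling common factors). A resistor has $V=RI$, an inductor has $V=L\dot I$, a capacitor has $\dot V=CI$. If $N_1,N_2$ have constitutive equations $f_1V=f_2I$ and $f_3V=f_4I$, then $N_1\wedge N_2$ has constitutive equation $f_1f_3V=(f_1f_4+f_2f_3)I$ and $N_1\vee N_2$ has constitutive equation $(f_1f_4+f_2f_3)V=f_2f_4I$. The equation is determined only up to a common factor, so it is normalized (made monic) by dividing by one of its nonzero coefficients. The non-monic coefficients are the remaining nonzero coefficients (on both sides together) of the normalized equation; their number $m$ is thus the total number of nonzero coefficients of $f_1$ and $f_2$ minus one. The coefficient map $\mathbf{c}:\mathbb{R}_{>0}^n\to\mathbb{R}^m$ sends the parameter values to the vector of these non-monic coefficients. The network is locally identifiable if $\mathbf{c}$ is generically finite-to-one: for all parameter vectors $p\in\mathbb{R}_{>0}^n$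 outside a proper algebraic subset, the fiber $\mathbf{c}^{-1}(\mathbf{c}(p))$ is finite. *)

theory Defs
  imports
    "HOL-Library.Poly_Mapping"
    "HOL-Library.FuncSet"
    "HOL-Computational_Algebra.Polynomial"
begin

text \<open>
  Real polynomials in the variables \<open>x\<^sub>0, x\<^sub>1, \<dots>\<close>: a monomial is the finitely supported
  map from variables to exponents, a polynomial the finitely supported map from monomials to
  coefficients. The ring structure is the one of \<^theory>\<open>HOL-Library.Poly_Mapping\<close>.
\<close>

type_synonym mpoly = "(nat \<Rightarrow>\<^sub>0 nat) \<Rightarrow>\<^sub>0 real"

definition mvar :: "nat \<Rightarrow> mpoly" where
  "mvar i = Poly_Mapping.single (Poly_Mapping.single i 1) 1"

definition mvars :: "mpoly \<Rightarrow> nat set" where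
  "mvars g = (\<Union>a\<in>Poly_Mapping.keys g. Poly_Mapping.keys a)"

definition meval :: "mpoly \<Rightarrow> (nat \<Rightarrow> real) \<Rightarrow> real" where
  "meval g x = (\<Sum>a\<in>Poly_Mapping.keys g. Poly_Mapping.lookup g a *
     (\<Prod>i\<in>Poly_Mapping.keys a. x i ^ Poly_Mapping.lookup a i))"

text \<open>
  Points of \<open>\<real>\<^sup>n\<close> are functions on \<open>{..<n}\<close>, extended by \<^const>\<open>undefined\<close> outside, so that
  equality and finiteness of sets of points have their usual meaning.
\<close>

definition real_space :: "nat \<Rightarrow> (nat \<Rightarrow> real) set" where
  "real_space n = {..<n} \<rightarrow>\<^sub>E UNIV"

definition pos_space :: "nat \<Rightarrow> (nat \<Rightarrow> real) set" where
  "pos_space n = {..<n} \<rightarrow>\<^sub>E {0<..}"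

definition algebraic_subset :: "nat \<Rightarrow> (nat \<Rightarrow> real) set \<Rightarrow> bool" where
  "algebraic_subset n A \<longleftrightarrow>
     (\<exists>S. (\<forall>g\<in>S. mvars g \<subseteq> {..<n}) \<and> A = {x \<in> real_space n. \<forall>g\<in>S. meval g x = 0})"

definition generically_finite_to_one :: "nat \<Rightarrow> ((nat \<Rightarrow> real) \<Rightarrow> 'b) \<Rightarrow> bool" where
  "generically_finite_to_one n c \<longleftrightarrow>
     (\<exists>A. algebraic_subset n A \<and> A \<noteq> real_space n \<and>
       (\<forall>p \<in> pos_space n - A. finite {q \<in> pos_space n. c q = c p}))"

datatype component = Resistor | Inductor | Capacitor

datatype network =
    Base component
  | Series network network
  | Parallel network network

fun components :: "network \<Rightarrow> component set" where
  "components (Base c) = {c}"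
| "components (Series N1 N2) = components N1 \<union> components N2"
| "components (Parallel N1 N2) = components N1 \<union> components N2"

fun num_params :: "network \<Rightarrow> nat" where
  "num_params (Base c) = 1"
| "num_params (Series N1 N2) = num_params N1 + num_params N2"
| "num_params (Parallel N1 N2) = num_params N1 + num_params N2"

text \<open>
  A pair \<open>(f\<^sub>1, f\<^sub>2)\<close> stands for the equation \<open>f\<^sub>1 V = f\<^sub>2 I\<close>; the indeterminate of the outer
  polynomial type is \<open>d/dt\<close>. The base elements carry the parameters \<open>x\<^sub>k, x\<^sub>k\<^sub>+\<^sub>1, \<dots>\<close> from left to
  right, so distinct base elements have distinct parameters. The parameter of a capacitor is its
  inverse capacitance.
\<close>

fun base_equation :: "component \<Rightarrow> mpoly \<Rightarrow> mpoly poly \<times> mpoly poly" where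
  "base_equation Resistor x = ([:1:], [:x:])"
| "base_equation Inductor x = ([:1:], [:0, x:])"
| "base_equation Capacitor x = ([:0, 1:], [:x:])"

fun equation_from :: "nat \<Rightarrow> network \<Rightarrow> mpoly poly \<times> mpoly poly" where
  "equation_from k (Base c) = base_equation c (mvar k)"
| "equation_from k (Series N1 N2) =
     (let (f1, f2) = equation_from k N1;
          (f3, f4) = equation_from (k + num_params N1) N2
      in (f1 * f3, f1 * f4 + f2 * f3))"
| "equation_from k (Parallel N1 N2) =
     (let (f1, f2) = equation_from k N1;
          (f3, f4) = equation_from (k + num_params N1) N2
      in (f1 * f4 + f2 * f3, f2 * f4))"

definition constitutive_equation :: "network \<Rightarrow> mpoly poly \<times> mpoly poly" where
  "constitutive_equation N = equation_from 0 N"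

text \<open>
  A coefficient of the equation is addressed by its side and the order of the derivative.
\<close>

datatype side = Voltage | Current

fun eq_coeff :: "network \<Rightarrow> side \<times> nat \<Rightarrow> mpoly" where
  "eq_coeff N (Voltage, i) = coeff (fst (constitutive_equation N)) i"
| "eq_coeff N (Current, i) = coeff (snd (constitutive_equation N)) i"

definition nonzero_coeffs :: "network \<Rightarrow> (side \<times> nat) set" where
  "nonzero_coeffs N = {j. eq_coeff N j \<noteq> 0}"

text \<open>
  Below, \<open>j\<^sub>0\<close> is the position of the nonzero coefficient by which the equation is divided. The
  coordinates of \<open>\<real>\<^sup>m\<close> are indexed by the positions of the non-monic coefficients. For positive
  parameters the division is never by zero, as all monomials have nonnegative coefficients.
\<close>

definition non_monic_coeffs :: "network \<Rightarrow> side \<times> nat \<Rightarrow> (side \<times> nat) set" where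
  "non_monic_coeffs N j0 = nonzero_coeffs N - {j0}"

definition coeff_map :: "network \<Rightarrow> side \<times> nat \<Rightarrow> (nat \<Rightarrow> real) \<Rightarrow> (side \<times> nat \<Rightarrow> real)" where
  "coeff_map N j0 p =
     (\<lambda>j \<in> non_monic_coeffs N j0. meval (eq_coeff N j) p / meval (eq_coeff N j0) p)"

definition locally_identifiable :: "network \<Rightarrow> side \<times> nat \<Rightarrow> bool" where
  "locally_identifiable N j0 \<longleftrightarrow> generically_finite_to_one (num_params N) (coeff_map N j0)"

end

theory Submission
  imports
    "HOL-Analysis.Analysis"
    "HOL-Computational_Algebra.Field_as_Ring"
    "HOL-Computational_Algebra.Polynomial_Factorial"
    "HOL-Computational_Algebra.Fundamental_Theorem_Algebra"
    Defs
begin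

text \<open>
  Replace each element of one of the two types by an inductor (current side \<open>x d/dt\<close>) and each element
  of the other type by a resistor (current side \<open>x\<close>). The equation of the given network arises from
  that of this RL network when a power of \<open>d/dt\<close> is substituted for \<open>d/dt\<close> and the two sides are shifted
  by powers of \<open>d/dt\<close>. So the two equations have the same coefficients, at different positions
  (\<open>two_types_coefficients\<close>). For such an RL equation the nonzero coefficients of either side fill an
  interval of exponents, and the four ends of the two intervals are computed along the network.
  Comparing them with the number of elements gives \<open>m \<le> n\<close> (\<open>num_positions_le\<close>).

  The heart of the matter is that the \<open>m + 1\<close> coefficients satisfy no homogeneous polynomial
  relation: the cone of all multiples of the pairs \<open>(f\<^sub>1, f\<^sub>2)\<close>, taken over the complex parameters, is
  Zariski dense among all pairs of complex polynomials with exponents in the two intervals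
  (\<open>cone_dense\<close>). This is proved along the network. A series connection maps \<open>(F\<^sub>1, F\<^sub>2)\<close> and
  \<open>(F\<^sub>3, F\<^sub>4)\<close> to \<open>(F\<^sub>1 F\<^sub>3, F\<^sub>1 F\<^sub>4 + F\<^sub>2 F\<^sub>3)\<close>. A generic first component splits over the complex numbers into
  coprime factors \<open>F\<^sub>1\<close>, \<open>F\<^sub>3\<close> of the required degrees; a partial fraction argument then reaches every
  second component, and the exponent intervals are exactly wide enough for it
  (\<open>solve_series_current\<close>). The parallel connection is the series connection with voltage and current
  exchanged.

  So the coefficient map is dominant onto \<open>\<real>\<^sup>m\<close>, and local identifiability becomes a comparison of
  dimensions. If \<open>m = n\<close>, every parameter is algebraic over the coefficients, since there are more
  monomials of bounded degree in the parameter and the coefficients than there is room for in \<open>n\<close>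
  variables; by independence this algebraic relation stays nontrivial at generic points and leaves
  finitely many values for the parameter (\<open>generically_finite_to_one_if_independent\<close>). If \<open>m < n\<close>, the
  Jacobian of the coefficient map has a nonzero kernel vector with polynomial entries; its flow moves
  a generic point inside its fibre, which is therefore infinite (\<open>not_generically_finite_to_one_if_few\<close>).
\<close>

section \<open>Evaluation of real polynomials in commutative algebras\<close>

definition monom_value :: "(nat \<Rightarrow> 'a::comm_ring_1) \<Rightarrow> (nat \<Rightarrow>\<^sub>0 nat) \<Rightarrow> 'a" where
  "monom_value x a = (\<Prod>i\<in>Poly_Mapping.keys a. x i ^ Poly_Mapping.lookup a i)"

definition aeval :: "(nat \<Rightarrow> 'a::{comm_ring_1, real_algebra_1}) \<Rightarrow> mpoly \<Rightarrow> 'a" where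
  "aeval x g = (\<Sum>a\<in>Poly_Mapping.keys g. of_real (Poly_Mapping.lookup g a) * monom_value x a)"

lemma meval_eq_aeval: "meval g x = aeval x g"
  by (simp add: meval_def aeval_def monom_value_def)

lemma monom_value_superset:
  assumes "finite I" "Poly_Mapping.keys a \<subseteq> I"
  shows "monom_value x a = (\<Prod>i\<in>I. x i ^ Poly_Mapping.lookup a i)"
  unfolding monom_value_def using assms
  by (intro prod.mono_neutral_left) (auto simp: in_keys_iff)

lemma monom_value_add: "monom_value x (a + b) = monom_value x a * monom_value x b"
proof -
  let ?I = "Poly_Mapping.keys a \<union> Poly_Mapping.keys b"
  have "monom_value x (a + b) = (\<Prod>i\<in>?I. x i ^ Poly_Mapping.lookup (a + b) i)"
    by (rule monom_value_superset) (auto simp: in_keys_iff lookup_add)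
  then show ?thesis
    by (simp add: lookup_add power_add prod.distrib monom_value_superset[of ?I])
qed

lemma aeval_superset:
  assumes "finite K" "Poly_Mapping.keys g \<subseteq> K"
  shows "aeval x g = (\<Sum>a\<in>K. of_real (Poly_Mapping.lookup g a) * monom_value x a)"
  unfolding aeval_def using assms
  by (intro sum.mono_neutral_left) (auto simp: in_keys_iff)

lemma aeval_add: "aeval x (g + h) = aeval x g + aeval x h"
proof -
  let ?K = "Poly_Mapping.keys g \<union> Poly_Mapping.keys h"
  have "aeval x (g + h) = (\<Sum>a\<in>?K. of_real (Poly_Mapping.lookup (g + h) a) * monom_value x a)"
    by (rule aeval_superset) (auto simp: in_keys_iff lookup_add)
  then show ?thesis
    by (simp add: lookup_add distrib_right sum.distrib aeval_superset[of ?K])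
qed

lemma aeval_zero [simp]: "aeval x 0 = 0"
  by (simp add: aeval_def)

lemma aeval_sum: "aeval x (sum f S) = (\<Sum>s\<in>S. aeval x (f s))"
  by (induction S rule: infinite_finite_induct) (auto simp: aeval_add)

lemma aeval_single: "aeval x (Poly_Mapping.single a c) = of_real c * monom_value x a"
  by (simp add: aeval_def)

text \<open>
  The expansion of a polynomial into its terms; applied to a single monomial it also writes an
  exponent vector as the sum of its entries.
\<close>

lemma sum_singles: "(\<Sum>a\<in>Poly_Mapping.keys g. Poly_Mapping.single a (Poly_Mapping.lookup g a)) = g"
  by (rule poly_mapping_eqI) (auto simp: lookup_sum lookup_single when_def in_keys_iff)

lemma mult_eq_sum_singles:
  fixes g h :: mpoly
  shows "g * h = (\<Sum>a\<in>Poly_Mapping.keys g. \<Sum>b\<in>Poly_Mapping.keys h.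
    Poly_Mapping.single (a + b) (Poly_Mapping.lookup g a * Poly_Mapping.lookup h b))"
proof -
  let ?s = "\<lambda>g a. Poly_Mapping.single a (Poly_Mapping.lookup g a)"
  have "g * h = (\<Sum>a\<in>Poly_Mapping.keys g. ?s g a) * (\<Sum>b\<in>Poly_Mapping.keys h. ?s h b)"
    by (simp add: sum_singles)
  then show ?thesis by (simp add: sum_product mult_single)
qed

lemma aeval_mult: "aeval x (g * h) = aeval x g * aeval x h"
  by (simp add: mult_eq_sum_singles aeval_sum aeval_single monom_value_add)
     (simp add: aeval_def sum_product mult_ac)

lemma aeval_one [simp]: "aeval x 1 = 1"
  by (simp add: single_one[symmetric] aeval_single monom_value_def del: single_one)

lemma aeval_mvar [simp]: "aeval x (mvar i) = x i"
  by (simp add: mvar_def aeval_single monom_value_def)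

lemma aeval_const: "aeval x (Poly_Mapping.single 0 c) = of_real c"
  by (simp add: aeval_single monom_value_def)

lemma aeval_uminus: "aeval x (- g) = - aeval x g"
  using aeval_add[of x g "- g"] by (simp add: eq_neg_iff_add_eq_0 add.commute)

lemma aeval_diff: "aeval x (g - h) = aeval x g - aeval x h"
  using aeval_add[of x g "- h"] by (simp add: aeval_uminus)

lemma aeval_power: "aeval x (g ^ k) = aeval x g ^ k"
  by (induction k) (auto simp: aeval_mult)

lemma aeval_prod: "aeval x (prod f S) = (\<Prod>s\<in>S. aeval x (f s))"
  by (induction S rule: infinite_finite_induct) (auto simp: aeval_mult)

lemmas aeval_simps = aeval_add aeval_mult aeval_uminus aeval_diff aeval_sum aeval_prod
  aeval_power aeval_const

lemma mvars_add: "mvars (g + h) \<subseteq> mvars g \<union> mvars h"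
  using keys_add[of g h] by (auto simp: mvars_def)

lemma mvars_mult: "mvars (g * h) \<subseteq> mvars g \<union> mvars h"
proof
  fix i assume "i \<in> mvars (g * h)"
  then obtain a where a: "a \<in> Poly_Mapping.keys (g * h)" "i \<in> Poly_Mapping.keys a"
    by (auto simp: mvars_def)
  with keys_mult[of g h] obtain b c where "a = b + c" "b \<in> Poly_Mapping.keys g"
    "c \<in> Poly_Mapping.keys h" by auto
  with a(2) keys_add[of b c] show "i \<in> mvars g \<union> mvars h"
    by (auto simp: mvars_def)
qed

lemma mvars_uminus [simp]: "mvars (- g) = mvars g"
  by (auto simp: mvars_def in_keys_iff)

lemma mvars_mvar [simp]: "mvars (mvar i) = {i}"
  by (simp add: mvars_def mvar_def)

lemma mvars_const [simp]: "mvars (Poly_Mapping.single 0 c) = {}"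
  by (simp add: mvars_def)

lemma mvars_zero [simp]: "mvars 0 = {}"
  by (simp add: mvars_def)

lemma mvars_one [simp]: "mvars 1 = {}"
  by (simp add: mvars_def single_one[symmetric] del: single_one)

lemma mvars_power: "mvars (g ^ k) \<subseteq> mvars g"
proof (induction k)
  case 0
  then show ?case by (simp add: mvars_def single_one[symmetric] del: single_one)
next
  case (Suc k)
  then show ?case using mvars_mult[of g "g ^ k"] by auto
qed

lemma mvars_sum: "(\<And>s. s \<in> S \<Longrightarrow> mvars (f s) \<subseteq> V) \<Longrightarrow> mvars (sum f S) \<subseteq> V"
proof (induction S rule: infinite_finite_induct)
  case (insert s S)
  then show ?case using mvars_add[of "f s" "sum f S"] by fastforce
qed (auto simp: mvars_def)

lemma mvars_prod: "(\<And>s. s \<in> S \<Longrightarrow> mvars (f s) \<subseteq> V) \<Longrightarrow> mvars (prod f S) \<subseteq> V"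
proof (induction S rule: infinite_finite_induct)
  case (insert s S)
  then show ?case using mvars_mult[of "f s" "prod f S"] by fastforce
qed (auto simp: mvars_def)

section \<open>Homogeneous linear systems over an integral domain\<close>

text \<open>
  More unknowns than equations leave a nonzero solution. Gaussian elimination without divisions
  works over any integral domain and keeps the solution in the subring \<open>G\<close> of the coefficients. It is
  needed over \<open>\<real>\<close>, to count monomials, and over the polynomials in the first \<open>n\<close> variables, to find a
  polynomial vector field.
\<close>

lemma kernel_vector_in_subring:
  fixes M :: "'i \<Rightarrow> 'u \<Rightarrow> 'c::idom"
  assumes "finite I" "finite U" "card I < card U"
    and "\<And>i u. M i u \<in> G"
    and "0 \<in> G" "1 \<in> G" "\<And>a b. a \<in> G \<Longrightarrow> b \<in> G \<Longrightarrow> a + b \<in> G"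
      "\<And>a b. a \<in> G \<Longrightarrow> b \<in> G \<Longrightarrow> a * b \<in> G" "\<And>a. a \<in> G \<Longrightarrow> - a \<in> G"
  shows "\<exists>v. (\<forall>u. v u \<in> G) \<and> (\<exists>u\<in>U. v u \<noteq> 0) \<and> (\<forall>i\<in>I. (\<Sum>u\<in>U. M i u * v u) = 0)"
  using assms(1-4)
proof (induction I arbitrary: U M rule: finite_induct)
  case empty
  then obtain u where "u \<in> U" by (cases "U = {}") auto
  then show ?case using assms(6) by (intro exI[of _ "\<lambda>_. 1"]) auto
next
  case (insert i I)
  note ring = assms(5-9)
  show ?case
  proof (cases "\<forall>u\<in>U. M i u = 0")
    case True
    have "card I < card U" using insert by simp
    from insert.IH[OF insert.prems(1) this insert.prems(3)] True show ?thesis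
      by fastforce
  next
    case False
    then obtain u0 where u0: "u0 \<in> U" "M i u0 \<noteq> 0" by auto
    define U' where "U' = U - {u0}"
    have U: "U = insert u0 U'" "u0 \<notin> U'" "finite U'"
      using u0 insert.prems(1) by (auto simp: U'_def)
    \<comment> \<open>Cross-multiplication eliminates the unknown \<open>u0\<close> by means of equation \<open>i\<close>.\<close>
    define M' where "M' k u = M i u0 * M k u + - (M k u0 * M i u)" for k u
    have "card I < card U'" using insert U by simp
    moreover have "M' k u \<in> G" for k u
      unfolding M'_def by (intro ring insert.prems(3))
    ultimately obtain v' where v': "\<And>u. v' u \<in> G" "\<exists>u\<in>U'. v' u \<noteq> 0"
      "\<And>k. k \<in> I \<Longrightarrow> (\<Sum>u\<in>U'. M' k u * v' u) = 0"
      using insert.IH[OF U(3), of M'] by blast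
    define s where "s = (\<Sum>u\<in>U'. M i u * v' u)"
    define v where "v u = (if u = u0 then - s else M i u0 * v' u)" for u
    have sum_in: "sum f S \<in> G" if "\<And>u. f u \<in> G" for f and S :: "'u set"
      by (induction S rule: infinite_finite_induct) (auto intro: ring that)
    have "s \<in> G" unfolding s_def by (intro sum_in ring insert.prems(3) v')
    then have "v u \<in> G" for u by (auto simp: v_def intro: ring insert.prems(3) v')
    moreover have "\<exists>u\<in>U. v u \<noteq> 0" using v'(2) u0 U by (auto simp: v_def)
    moreover have row: "(\<Sum>u\<in>U. M k u * v u) = - (M k u0 * s) + M i u0 * (\<Sum>u\<in>U'. M k u * v' u)" for k
    proof -
      have "(\<Sum>u\<in>U'. M k u * v u) = (\<Sum>u\<in>U'. M i u0 * (M k u * v' u))"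
        using U(2) by (intro sum.cong) (auto simp: v_def)
      then show ?thesis using U by (simp add: v_def sum_distrib_left)
    qed
    have "(\<Sum>u\<in>U. M k u * v u) = 0" if "k \<in> I" for k
    proof -
      have "0 = (\<Sum>u\<in>U'. M' k u * v' u)" using v'(3)[OF that] by simp
      also have "\<dots> = M i u0 * (\<Sum>u\<in>U'. M k u * v' u) - M k u0 * s"
        by (simp add: M'_def s_def algebra_simps sum_subtractf sum_distrib_left)
      finally show ?thesis using row[of k] by simp
    qed
    moreover have "(\<Sum>u\<in>U. M i u * v u) = 0"
      using row[of i] by (simp add: s_def)
    ultimately show ?thesis by (intro exI[of _ v]) auto
  qed
qed

section \<open>Kronecker substitution\<close>

text \<open>
  Substituting \<open>t\<close> raised to \<open>w i\<close> for the variable \<open>i\<close> keeps the monomials with exponents at most \<open>D\<close>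
  apart: as weights one can take the place values of a positional system whose base exceeds \<open>D\<close>.
\<close>

lemma kronecker_weights:
  assumes "finite I"
  shows "\<exists>w::'i \<Rightarrow> nat. inj_on (\<lambda>b. \<Sum>i\<in>I. w i * b i) (I \<rightarrow>\<^sub>E {..D})"
  using assms
proof (induction I rule: finite_induct)
  case empty
  then show ?case by simp
next
  case (insert j I)
  then obtain w where w: "inj_on (\<lambda>b. \<Sum>i\<in>I. w i * b i) (I \<rightarrow>\<^sub>E {..D})" by auto
  \<comment> \<open>\<open>B\<close> exceeds every value of the old weighted sum, so division by \<open>B\<close> recovers \<open>b j\<close>.\<close>
  define B where "B = Suc (\<Sum>i\<in>I. w i * D)"
  define w' where "w' = w(j := B)"
  have split: "(\<Sum>i\<in>insert j I. w' i * b i) = B * b j + (\<Sum>i\<in>I. w i * b i)" for b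
  proof -
    have "(\<Sum>i\<in>I. w' i * b i) = (\<Sum>i\<in>I. w i * b i)"
      using insert(2) by (intro sum.cong) (auto simp: w'_def)
    then show ?thesis using insert(1,2) by (simp add: w'_def)
  qed
  have small: "(\<Sum>i\<in>I. w i * b i) < B" if "b \<in> insert j I \<rightarrow>\<^sub>E {..D}" for b
    unfolding B_def using that by (intro le_imp_less_Suc sum_mono) (auto simp: PiE_def Pi_def)
  have "inj_on (\<lambda>b. \<Sum>i\<in>insert j I. w' i * b i) (insert j I \<rightarrow>\<^sub>E {..D})"
  proof (rule inj_onI)
    fix b c assume bc: "b \<in> insert j I \<rightarrow>\<^sub>E {..D}" "c \<in> insert j I \<rightarrow>\<^sub>E {..D}"
      and "(\<Sum>i\<in>insert j I. w' i * b i) = (\<Sum>i\<in>insert j I. w' i * c i)"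
    then have eq: "B * b j + (\<Sum>i\<in>I. w i * b i) = B * c j + (\<Sum>i\<in>I. w i * c i)"
      by (simp only: split)
    from arg_cong[OF this, of "\<lambda>m. m div B"] have "b j = c j"
      using small[OF bc(1)] small[OF bc(2)] by simp
    with eq have "(\<Sum>i\<in>I. w i * b i) = (\<Sum>i\<in>I. w i * c i)" by simp
    then have "(\<Sum>i\<in>I. w i * restrict b I i) = (\<Sum>i\<in>I. w i * restrict c I i)" by simp
    moreover have "restrict b I \<in> I \<rightarrow>\<^sub>E {..D}" "restrict c I \<in> I \<rightarrow>\<^sub>E {..D}"
      using bc by auto
    ultimately have "restrict b I = restrict c I" by (intro inj_onD[OF w])
    then have "b i = c i" if "i \<in> I" for i using that by (metis restrict_apply')
    with \<open>b j = c j\<close> show "b = c"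
      using bc by (intro PiE_ext[of b "insert j I" _ c]) auto
  qed
  then show ?case by blast
qed

lemma sum_powers_eq_0:
  fixes c :: "'b \<Rightarrow> 'a::{idom,ring_char_0}"
  assumes "finite B" "inj_on e B" and "infinite {t. (\<Sum>b\<in>B. c b * t ^ e b) = 0}" and "b \<in> B"
  shows "c b = 0"
proof -
  define q where "q = (\<Sum>b\<in>B. monom (c b) (e b))"
  have "poly q t = (\<Sum>b\<in>B. c b * t ^ e b)" for t by (simp add: q_def poly_sum poly_monom)
  with assms(3) have "infinite {t. poly q t = 0}" by simp
  then have "q = 0" using poly_roots_finite by blast
  then have "0 = coeff q (e b)" by simp
  also have "\<dots> = (\<Sum>b'\<in>B. if e b' = e b then c b' else 0)"
    by (simp add: q_def coeff_sum)
  also have "\<dots> = (\<Sum>b'\<in>B. if b' = b then c b' else 0)"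
    using assms(2,4) by (intro sum.cong) (auto dest: inj_onD)
  also have "\<dots> = c b" using assms(1,4) by simp
  finally show ?thesis by simp
qed

text \<open>
  After a Kronecker substitution the polynomial becomes a nonzero polynomial in one variable, which
  cannot vanish for all positive \<open>t\<close>.
\<close>

lemma nonzero_mpoly_nonzero_at_positive_point:
  assumes "g \<noteq> 0" "mvars g \<subseteq> {..<n}"
  shows "\<exists>p\<in>pos_space n. meval g p \<noteq> 0"
proof -
  let ?K = "Poly_Mapping.keys g"
  define D where "D = Max (insert 0 (\<Union>a\<in>?K. Poly_Mapping.lookup a ` {..<n}))"
  have D: "Poly_Mapping.lookup a i \<le> D" if "a \<in> ?K" "i < n" for a i
    unfolding D_def using that by (intro Max_ge) auto
  obtain w :: "nat \<Rightarrow> nat" where w: "inj_on (\<lambda>b. \<Sum>i<n. w i * b i) ({..<n} \<rightarrow>\<^sub>E {..D})"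
    using kronecker_weights[of "{..<n}" D] by auto
  define e where "e a = (\<Sum>i<n. w i * Poly_Mapping.lookup a i)" for a :: "nat \<Rightarrow>\<^sub>0 nat"
  have vars: "Poly_Mapping.keys a \<subseteq> {..<n}" if "a \<in> ?K" for a
    using assms(2) that by (auto simp: mvars_def)
  have "inj_on e ?K"
  proof (rule inj_onI)
    fix a b assume ab: "a \<in> ?K" "b \<in> ?K" "e a = e b"
    have "restrict (Poly_Mapping.lookup a) {..<n} = restrict (Poly_Mapping.lookup b) {..<n}"
      using ab D by (intro inj_onD[OF w]) (auto simp: e_def)
    then have "Poly_Mapping.lookup a i = Poly_Mapping.lookup b i" if "i < n" for i
      using that by (metis lessThan_iff restrict_apply')
    moreover have "Poly_Mapping.lookup a i = Poly_Mapping.lookup b i" if "\<not> i < n" for i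
      using vars[OF ab(1)] vars[OF ab(2)] that by (metis in_keys_iff lessThan_iff subsetD)
    ultimately show "a = b" by (intro poly_mapping_eqI) blast
  qed
  define p where "p t = (\<lambda>i\<in>{..<n}. t ^ w i)" for t :: real
  have val: "meval g (p t) = (\<Sum>a\<in>?K. Poly_Mapping.lookup g a * t ^ e a)" for t
    unfolding meval_eq_aeval aeval_def of_real_eq_id id_apply
  proof (intro sum.cong refl arg_cong2[of _ _ _ _ "(*)"])
    fix a assume "a \<in> ?K"
    then show "monom_value (p t) a = t ^ e a"
      by (subst monom_value_superset[of "{..<n}"])
         (auto simp: p_def e_def power_sum power_mult vars)
  qed
  have "\<exists>t>0. meval g (p t) \<noteq> 0"
  proof (rule ccontr)
    assume "\<not> ?thesis"
    then have "{0<..} \<subseteq> {t. (\<Sum>a\<in>?K. Poly_Mapping.lookup g a * t ^ e a) = 0}"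
      by (auto simp: val)
    then have "infinite {t. (\<Sum>a\<in>?K. Poly_Mapping.lookup g a * t ^ e a) = 0}"
      using infinite_super infinite_Ioi by blast
    then have "Poly_Mapping.lookup g a = 0" if "a \<in> ?K" for a
      by (rule sum_powers_eq_0[OF finite_keys \<open>inj_on e ?K\<close> _ that])
    then have "g = 0" by (metis ex_in_conv in_keys_iff keys_eq_empty)
    with assms(1) show False by simp
  qed
  then obtain t where "t > 0" "meval g (p t) \<noteq> 0" by blast
  then show ?thesis by (intro bexI[of _ "p t"]) (auto simp: p_def pos_space_def)
qed

section \<open>Polynomial functions and Zariski density\<close>

fun coord :: "side \<times> nat \<Rightarrow> 'a::zero poly \<times> 'a poly \<Rightarrow> 'a" where
  "coord (Voltage, i) s = coeff (fst s) i"
| "coord (Current, i) s = coeff (snd s) i"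

text \<open>
  Polynomials in the coefficients of a pair of complex polynomials, as functions of the pair. Zariski
  density of a set \<open>S\<close> in a set \<open>T\<close> of pairs then says that a polynomial function which vanishes on \<open>S\<close>
  vanishes on \<open>T\<close>.
\<close>

inductive polyfun :: "(complex poly \<times> complex poly \<Rightarrow> complex) \<Rightarrow> bool" where
  polyfun_const: "polyfun (\<lambda>_. c)"
| polyfun_coord: "polyfun (coord j)"
| polyfun_add: "polyfun P \<Longrightarrow> polyfun Q \<Longrightarrow> polyfun (\<lambda>s. P s + Q s)"
| polyfun_mult: "polyfun P \<Longrightarrow> polyfun Q \<Longrightarrow> polyfun (\<lambda>s. P s * Q s)"

lemma polyfun_sum:
  assumes "\<And>b. b \<in> B \<Longrightarrow> polyfun (P b)"
  shows "polyfun (\<lambda>s. \<Sum>b\<in>B. P b s)"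
  using assms
proof (induction B rule: infinite_finite_induct)
  case (insert b B)
  then show ?case by (simp add: polyfun_add)
qed (auto intro: polyfun_const)

lemma polyfun_power: "polyfun P \<Longrightarrow> polyfun (\<lambda>s. P s ^ k)"
  by (induction k) (auto intro: polyfun_const polyfun_mult)

lemma polyfun_prod:
  assumes "\<And>b. b \<in> B \<Longrightarrow> polyfun (P b)"
  shows "polyfun (\<lambda>s. \<Prod>b\<in>B. P b s)"
  using assms
proof (induction B rule: infinite_finite_induct)
  case (insert b B)
  then show ?case by (simp add: polyfun_mult)
qed (auto intro: polyfun_const)

lemma polyfun_compose:
  assumes "polyfun Q" and "\<And>j. polyfun (\<lambda>s. coord j (F s))"
  shows "polyfun (\<lambda>s. Q (F s))"
  using assms(1) by induction (use assms(2) in \<open>auto intro: polyfun.intros\<close>)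

text \<open>
  Curves whose coefficients are polynomials in the curve parameter. A polynomial function restricted
  to such a curve is a polynomial in one variable, which makes generic choices elementary: a point
  lies in the closure of \<open>S\<close> as soon as it is the endpoint of a curve that lies in \<open>S\<close> outside finitely
  many parameters.
\<close>

definition poly_curve :: "(complex \<Rightarrow> complex poly) \<Rightarrow> bool" where
  "poly_curve g \<longleftrightarrow> (\<forall>i. \<exists>q. \<forall>z. coeff (g z) i = poly q z)"

lemma poly_curve_const: "poly_curve (\<lambda>_. f)"
proof -
  have "\<forall>z. coeff f i = poly [:coeff f i:] z" for i by simp
  then show ?thesis unfolding poly_curve_def by blast
qed

lemma poly_curve_add:
  assumes "poly_curve f" "poly_curve g"
  shows "poly_curve (\<lambda>z. f z + g z)"
  unfolding poly_curve_def
proof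
  fix i
  from assms obtain p q where "\<forall>z. coeff (f z) i = poly p z" "\<forall>z. coeff (g z) i = poly q z"
    unfolding poly_curve_def by blast
  then have "\<forall>z. coeff (f z + g z) i = poly (p + q) z" by simp
  then show "\<exists>q. \<forall>z. coeff (f z + g z) i = poly q z" by blast
qed

lemma poly_curve_mult:
  assumes "poly_curve f" "poly_curve g"
  shows "poly_curve (\<lambda>z. f z * g z)"
  unfolding poly_curve_def
proof
  fix i
  from assms obtain p q where "\<And>i z. coeff (f z) i = poly (p i) z" "\<And>i z. coeff (g z) i = poly (q i) z"
    unfolding poly_curve_def by metis
  then have "\<forall>z. coeff (f z * g z) i = poly (\<Sum>k\<le>i. p k * q (i - k)) z"
    by (simp add: coeff_mult poly_sum)
  then show "\<exists>q. \<forall>z. coeff (f z * g z) i = poly q z" by blast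
qed

lemma poly_curve_monom: "poly_curve (\<lambda>z. monom (a * z) k)"
proof -
  have "\<forall>z. coeff (monom (a * z) k) i = poly (if i = k then [:0, a:] else 0) z" for i
    by (simp add: mult.commute)
  then show ?thesis unfolding poly_curve_def by blast
qed

lemma poly_curve_translate: "poly_curve (\<lambda>z. f \<circ>\<^sub>p [:a * z, 1:])"
proof (induction f)
  case 0
  then show ?case by (simp add: poly_curve_const)
next
  case (pCons c f)
  have "poly_curve (\<lambda>z. monom (a * z) 0 + [:0, 1:])"
    by (intro poly_curve_add poly_curve_monom poly_curve_const)
  then have "poly_curve (\<lambda>z. [:a * z, 1:])" by (simp add: monom_0)
  then show ?case
    unfolding pcompose_pCons by (intro poly_curve_add poly_curve_mult poly_curve_const pCons.IH)
qed

lemma polyfun_along_curve: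
  assumes "polyfun Q" "poly_curve f" "poly_curve g"
  shows "\<exists>q. \<forall>z. Q (f z, g z) = poly q z"
  using assms(1)
proof induction
  case (polyfun_const c)
  show ?case by (intro exI[of _ "[:c:]"]) simp
next
  case (polyfun_coord j)
  obtain side i where "j = (side, i)" by fastforce
  then show ?case using assms(2,3) by (cases side) (auto simp: poly_curve_def)
next
  case (polyfun_add P Q)
  then obtain p q where "\<forall>z. P (f z, g z) = poly p z" "\<forall>z. Q (f z, g z) = poly q z" by blast
  then show ?case by (intro exI[of _ "p + q"]) simp
next
  case (polyfun_mult P Q)
  then obtain p q where "\<forall>z. P (f z, g z) = poly p z" "\<forall>z. Q (f z, g z) = poly q z" by blast
  then show ?case by (intro exI[of _ "p * q"]) simp
qed

lemma polyfun_zero_at_end_of_curve: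
  assumes "polyfun Q" "poly_curve f" "poly_curve g"
    and "finite E" "\<And>z. z \<notin> E \<Longrightarrow> Q (f z, g z) = 0"
  shows "Q (f 0, g 0) = 0"
proof -
  obtain q where q: "\<And>z. Q (f z, g z) = poly q z"
    using polyfun_along_curve[OF assms(1-3)] by blast
  have "- E \<subseteq> {z. poly q z = 0}" using assms(5) q by auto
  moreover have "infinite (- E)" using assms(4) by (simp add: infinite_UNIV_char_0 Compl_eq_Diff_UNIV)
  ultimately have "q = 0" using poly_roots_finite infinite_super by metis
  then show ?thesis using q by simp
qed

section \<open>The Diophantine equation of a series connection\<close>

lemma complex_poly_split:
  fixes p :: "complex poly"
  assumes "degree p = a + b"
  shows "\<exists>f g. p = f * g \<and> degree f = a \<and> degree g = b"
  using assms
proof (induction a arbitrary: p)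
  case 0
  then show ?case by (intro exI[of _ 1] exI[of _ p]) simp
next
  case (Suc a)
  then have "\<not> constant (poly p)" by (simp add: constant_degree)
  then obtain r where "poly p r = 0" using fundamental_theorem_of_algebra by blast
  then obtain q where q: "p = [:- r, 1:] * q" by (metis dvdE poly_eq_0_iff_dvd)
  have "q \<noteq> 0" using q Suc.prems by auto
  then have "degree p = Suc (degree q)" unfolding q by (subst degree_mult_eq) auto
  then obtain f g where "q = f * g" "degree f = a" "degree g = b" using Suc by force
  moreover from this \<open>q \<noteq> 0\<close> have "degree ([:- r, 1:] * f) = Suc a"
    by (subst degree_mult_eq) auto
  ultimately show ?case using q by (metis mult.assoc)
qed

text \<open>
  Over the complex numbers coprimality is the absence of common roots.
\<close>

lemma complex_poly_bezout:
  fixes A B :: "complex poly"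
  assumes "\<And>x. \<not> (poly A x = 0 \<and> poly B x = 0)"
  shows "\<exists>u v. u * A + v * B = 1"
proof -
  let ?g = "gcd A B"
  have g: "?g dvd A" "?g dvd B" by auto
  have "poly ?g x \<noteq> 0" for x
    using assms[of x] g by (metis dvdE mult_zero_left poly_mult)
  then have "constant (poly ?g)" using fundamental_theorem_of_algebra by blast
  then obtain c where c: "?g = [:c:]" by (metis constant_degree degree_eq_zeroE)
  have "c \<noteq> 0" using \<open>\<And>x. poly ?g x \<noteq> 0\<close>[of 0] c by simp
  obtain u v where "u * A + v * B = ?g" by (metis bezout_coefficients_fst_snd)
  then have "smult (inverse c) u * A + smult (inverse c) v * B = smult (inverse c) [:c:]"
    using c by (metis mult_smult_left smult_add_right)
  also have "\<dots> = 1" using \<open>c \<noteq> 0\<close> by (simp add: one_pCons)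
  finally show ?thesis by blast
qed

text \<open>
  The exponents of \<open>f\<close> lie between \<open>l\<close> and \<open>h\<close>; the zero polynomial is supported anywhere.
\<close>

definition supported :: "nat \<Rightarrow> nat \<Rightarrow> 'a::zero poly \<Rightarrow> bool" where
  "supported l h f \<longleftrightarrow> (\<forall>i. coeff f i \<noteq> 0 \<longrightarrow> l \<le> i \<and> i \<le> h)"

lemma supported_monom_mult:
  fixes f :: "'a::comm_ring_1 poly"
  assumes "degree f + l \<le> h"
  shows "supported l h (monom 1 l * f)"
proof -
  have "l \<le> i \<and> i \<le> h" if "coeff (monom 1 l * f) i \<noteq> 0" for i
  proof -
    from that have "l \<le> i" "coeff f (i - l) \<noteq> 0"
      by (auto simp: coeff_monom_mult split: if_splits)
    then show ?thesis using le_degree[of f "i - l"] assms by linarith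
  qed
  then show ?thesis by (simp add: supported_def)
qed

lemma supported_obtain:
  fixes f :: "'a::comm_ring_1 poly"
  assumes "supported l h f" "l \<le> h"
  obtains f' where "f = monom 1 l * f'" "degree f' + l \<le> h"
proof
  let ?f' = "poly_shift l f"
  show "f = monom 1 l * ?f'"
    using assms(1) by (intro poly_eqI) (auto simp: coeff_monom_mult coeff_poly_shift supported_def)
  have "degree ?f' \<le> h - l"
    using assms(1) by (intro degree_le) (force simp: coeff_poly_shift supported_def)
  with assms(2) show "degree ?f' + l \<le> h" by simp
qed

text \<open>
  With \<open>F\<^sub>1\<close> and \<open>F\<^sub>3\<close> prescribed, the current side \<open>F\<^sub>1 F\<^sub>4 + F\<^sub>2 F\<^sub>3\<close> of a series connection takes every
  value \<open>G\<close> that its exponent bounds permit. After division by the lowest power of \<open>d/dt\<close> that occurs,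
  this is an equation \<open>A d + b B = g\<close> with coprime \<open>A\<close> and \<open>B\<close>. Take for \<open>b\<close> the solution modulo \<open>A\<close> of
  degree less than the degree of \<open>A\<close>; the degree of \<open>d\<close> is then forced. The last four bounds say that
  neither difference of lower ends exceeds either difference of upper ends by more than one, which
  is what makes \<open>b\<close> and \<open>d\<close> fit. The upper bound \<open>h1 + h4\<close> on \<open>G\<close> treats the case in which it is not
  smaller than \<open>h2 + h3\<close>.
\<close>

lemma solve_series_current:
  fixes f1 f3 G :: "complex poly"
  assumes deg: "degree f1 + l1 = h1" "degree f3 + l3 \<le> h3" "f1 \<noteq> 0"
    and no_root: "poly f1 0 \<noteq> 0" "poly f3 0 \<noteq> 0"
      "\<And>x. \<not> (poly f1 x = 0 \<and> poly f3 x = 0)"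
    and G: "supported (min (l1 + l4) (l2 + l3)) (h1 + h4) G"
    and bounds: "l2 \<le> h2" "l4 \<le> h4"
      "l2 + h1 \<le> h2 + l1 + 1" "l4 + h1 \<le> h2 + l3 + 1"
      "l2 + h3 \<le> h4 + l1 + 1" "l4 + h3 \<le> h4 + l3 + 1"
  shows "\<exists>F2 F4. supported l2 h2 F2 \<and> supported l4 h4 F4 \<and>
           monom 1 l1 * f1 * F4 + F2 * (monom 1 l3 * f3) = G"
proof -
  define m where "m = min (l1 + l4) (l2 + l3)"
  have mh: "m \<le> h1 + h4" using deg(1) bounds(2) by (simp add: m_def)
  obtain g where g: "G = monom 1 m * g" "degree g + m \<le> h1 + h4"
    using supported_obtain[OF G[folded m_def] mh] by blast
  define A where "A = monom 1 (l1 + l4 - m) * f1"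
  define B where "B = monom 1 (l2 + l3 - m) * f3"
  have "\<not> (poly A x = 0 \<and> poly B x = 0)" for x
  proof (cases "x = 0")
    case True
    \<comment> \<open>The minimum \<open>m\<close> is attained, so \<open>A\<close> or \<open>B\<close> lacks the factor \<open>d/dt\<close>.\<close>
    have "l1 + l4 - m = 0 \<or> l2 + l3 - m = 0" by (auto simp: m_def)
    then show ?thesis using True no_root(1,2) by (auto simp: A_def B_def poly_monom)
  next
    case False
    then show ?thesis using no_root(3)[of x] by (simp add: A_def B_def poly_monom)
  qed
  then obtain u v where uv: "u * A + v * B = 1" using complex_poly_bezout by blast
  define b where "b = (v * g) mod A"
  define k where "k = (v * g) div A"
  define d where "d = u * g + k * B"
  have vg: "v * g = k * A + b" by (simp add: b_def k_def)
  have eq: "A * d + b * B = g"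
  proof -
    have "g = g * (u * A + v * B)" using uv by simp
    also have "\<dots> = A * (u * g) + (v * g) * B" by (simp add: algebra_simps)
    also have "\<dots> = A * d + b * B" by (simp only: vg d_def) (simp add: algebra_simps)
    finally show ?thesis by simp
  qed
  have "A \<noteq> 0" using deg(3) by (simp add: A_def)
  have dA: "degree A + m = h1 + l4"
    unfolding A_def using deg(1,3)
    by (subst degree_mult_eq) (auto simp: degree_monom_eq m_def)
  have dB: "degree B + m \<le> h3 + l2"
    using deg(2) degree_mult_le[of "monom 1 (l2 + l3 - m)" f3]
    by (auto simp: B_def degree_monom_eq m_def)
  have b_small: "b = 0 \<or> degree b < degree A"
    unfolding b_def using degree_mod_less[OF \<open>A \<noteq> 0\<close>] by blast
  have "degree b + l2 \<le> h2"
    using b_small dA bounds(1,3,4) by (auto simp: m_def min_def split: if_splits)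
  moreover have "degree d + l4 \<le> h4"
  proof (cases "d = 0")
    case False
    have "degree A + degree d = degree (A * d)" using False \<open>A \<noteq> 0\<close> by (simp add: degree_mult_eq)
    also have "A * d = g - b * B" using eq by (simp add: algebra_simps)
    finally have dd: "degree A + degree d = degree (g - b * B)" .
    show ?thesis
    proof (cases "b = 0")
      case True
      then show ?thesis using dd dA g(2) by simp
    next
      case b: False
      have "degree (g - b * B) \<le> max (degree g) (degree b + degree B)"
        using degree_diff_le_max[of g "b * B"] degree_mult_le[of b B] by linarith
      moreover have "degree b < degree A" using b b_small by simp
      ultimately have "degree A + degree d \<le> degree g \<or> degree d < degree B"
        using dd by linarith
      then show ?thesis
        using dA dB g(2) bounds by (auto simp: m_def min_def split: if_splits)
    qed
  qed (use bounds in simp)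
  moreover have "monom 1 l1 * f1 * (monom 1 l4 * d) + (monom 1 l2 * b) * (monom 1 l3 * f3) = G"
  proof -
    have "m \<le> l1 + l4" "m \<le> l2 + l3" by (simp_all add: m_def)
    then have e: "monom 1 l1 * monom 1 l4 = (monom 1 m * monom 1 (l1 + l4 - m) :: complex poly)"
      "monom 1 l2 * monom 1 l3 = (monom 1 m * monom 1 (l2 + l3 - m) :: complex poly)"
      by (simp_all add: mult_monom)
    have "monom 1 l1 * f1 * (monom 1 l4 * d) = (monom 1 l1 * monom 1 l4) * (f1 * d)"
      "monom 1 l2 * b * (monom 1 l3 * f3) = (monom 1 l2 * monom 1 l3) * (b * f3)"
      by (simp_all only: mult_ac)
    then have parts: "monom 1 l1 * f1 * (monom 1 l4 * d) = monom 1 m * (A * d)"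
      "monom 1 l2 * b * (monom 1 l3 * f3) = monom 1 m * (b * B)"
      unfolding e by (simp_all only: A_def B_def mult_ac)
    show ?thesis unfolding parts distrib_left[symmetric] eq g(1) by (rule refl)
  qed
  ultimately show ?thesis using supported_monom_mult by blast
qed

section \<open>Series connection of generic pairs\<close>

text \<open>
  The quadruple bounds the exponents of the voltage side from below and above, then those of the
  current side.
\<close>

definition pair_box :: "nat \<times> nat \<times> nat \<times> nat \<Rightarrow> (complex poly \<times> complex poly) set" where
  "pair_box = (\<lambda>(l1, h1, l2, h2). {(f, g). supported l1 h1 f \<and> supported l2 h2 g})"

text \<open>
  The rule for series connections. With the components of its arguments and of its value exchanged it
  is the rule for parallel connections.
\<close>

definition series :: "'a::comm_ring_1 poly \<times> 'a poly \<Rightarrow> 'a poly \<times> 'a poly \<Rightarrow> 'a poly \<times> 'a poly" where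
  "series s t = (fst s * fst t, fst s * snd t + snd s * fst t)"

lemma series_commute: "series s t = series t s"
  by (simp add: series_def mult.commute add.commute)

text \<open>
  If the first component has the largest possible degree, split it into \<open>f1\<close> and \<open>f3\<close>. Translating
  the roots of \<open>f1\<close> by \<open>z\<close> and those of \<open>f3\<close> by \<open>- z\<close> makes the factors coprime and nonzero at \<open>0\<close> for
  all but finitely many \<open>z\<close>. For these \<open>z\<close> the translated pair is a series combination, and \<open>z = 0\<close>
  gives back the original pair.
\<close>

lemma vanish_if_top_coefficient_nonzero:
  assumes Q: "polyfun Q"
    and zero: "\<And>s t. s \<in> pair_box (l1, h1, l2, h2) \<Longrightarrow> t \<in> pair_box (l3, h3, l4, h4) \<Longrightarrow> Q (series s t) = 0"
    and G: "G1 = monom 1 (l1 + l3) * g1" "degree g1 + l1 + l3 = h1 + h3" "g1 \<noteq> 0"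
      "supported (min (l1 + l4) (l2 + l3)) (h1 + h4) G2"
    and bounds: "l1 \<le> h1" "l3 \<le> h3" "l2 \<le> h2" "l4 \<le> h4"
      "l2 + h1 \<le> h2 + l1 + 1" "l4 + h1 \<le> h2 + l3 + 1"
      "l2 + h3 \<le> h4 + l1 + 1" "l4 + h3 \<le> h4 + l3 + 1"
  shows "Q (G1, G2) = 0"
proof -
  have "degree g1 = (h1 - l1) + (h3 - l3)" using G(2) bounds(1,2) by simp
  then obtain f1 f3 where f: "g1 = f1 * f3" "degree f1 = h1 - l1" "degree f3 = h3 - l3"
    using complex_poly_split by blast
  have nz: "f1 \<noteq> 0" "f3 \<noteq> 0" using f(1) G(3) by auto
  define c1 where "c1 z = f1 \<circ>\<^sub>p [:- 1 * z, 1:]" for z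
  define c3 where "c3 z = f3 \<circ>\<^sub>p [:1 * z, 1:]" for z
  \<comment> \<open>The exceptional parameters: a translated factor vanishes at \<open>0\<close>, or two translated roots meet.\<close>
  define E where "E = uminus ` {x. poly f1 x = 0} \<union> {x. poly f3 x = 0} \<union>
    (\<lambda>(x, y). (y - x) / 2) ` ({x. poly f1 x = 0} \<times> {x. poly f3 x = 0})"
  have "finite E"
    unfolding E_def using nz by (intro finite_UnI finite_imageI finite_cartesian_product poly_roots_finite)
  have curve: "poly_curve (\<lambda>z. monom 1 (l1 + l3) * (c1 z * c3 z))"
    unfolding c1_def c3_def
    by (intro poly_curve_mult poly_curve_const poly_curve_translate)
  have "Q (monom 1 (l1 + l3) * (c1 z * c3 z), G2) = 0" if "z \<notin> E" for z
  proof -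
    have d: "degree (c1 z) = h1 - l1" "degree (c3 z) = h3 - l3"
      using f by (simp_all add: c1_def c3_def degree_pcompose)
    have "c1 z \<noteq> 0" unfolding c1_def using nz(1) by (subst pcompose_eq_0_iff) auto
    have "poly (c1 z) 0 \<noteq> 0"
    proof
      assume "poly (c1 z) 0 = 0"
      then have "poly f1 (- z) = 0" by (simp add: c1_def poly_pcompose)
      then have "z \<in> uminus ` {x. poly f1 x = 0}" by (intro image_eqI[of _ _ "- z"]) auto
      with that show False by (simp add: E_def)
    qed
    moreover have "poly (c3 z) 0 \<noteq> 0"
      using that by (auto simp: c3_def poly_pcompose E_def)
    moreover have "\<not> (poly (c1 z) x = 0 \<and> poly (c3 z) x = 0)" for x
    proof
      assume "poly (c1 z) x = 0 \<and> poly (c3 z) x = 0"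
      then have "poly f1 (x - z) = 0" "poly f3 (x + z) = 0"
        by (simp_all add: c1_def c3_def poly_pcompose add.commute)
      then have "z \<in> (\<lambda>(x, y). (y - x) / 2) ` ({x. poly f1 x = 0} \<times> {x. poly f3 x = 0})"
        by (intro image_eqI[of _ _ "(x - z, x + z)"]) auto
      with that show False by (simp add: E_def)
    qed
    moreover have "degree (c1 z) + l1 = h1" "degree (c3 z) + l3 \<le> h3" using d bounds by auto
    ultimately obtain F2 F4 where F: "supported l2 h2 F2" "supported l4 h4 F4"
      "monom 1 l1 * c1 z * F4 + F2 * (monom 1 l3 * c3 z) = G2"
      using solve_series_current[of "c1 z" l1 h1 "c3 z" l3 h3 l4 l2 h4 G2 h2] \<open>c1 z \<noteq> 0\<close> G(4) bounds
      by blast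
    have "Q (series (monom 1 l1 * c1 z, F2) (monom 1 l3 * c3 z, F4)) = 0"
      using F d bounds by (intro zero) (auto simp: pair_box_def intro!: supported_monom_mult)
    moreover have "series (monom 1 l1 * c1 z, F2) (monom 1 l3 * c3 z, F4)
        = (monom 1 (l1 + l3) * (c1 z * c3 z), G2)"
    proof -
      have "monom 1 (l1 + l3) = (monom 1 l1 * monom 1 l3 :: complex poly)" by (simp add: mult_monom)
      then show ?thesis by (simp add: series_def F(3)[symmetric] mult_ac)
    qed
    ultimately show ?thesis by simp
  qed
  from polyfun_zero_at_end_of_curve[OF Q curve poly_curve_const \<open>finite E\<close> this]
  show ?thesis by (simp add: c1_def c3_def G(1) f(1))
qed

text \<open>
  A first component of smaller degree is the endpoint of the line obtained by adding a multiple of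
  the top monomial.
\<close>

lemma vanish_if_second_dominates:
  assumes Q: "polyfun Q"
    and zero: "\<And>s t. s \<in> pair_box (l1, h1, l2, h2) \<Longrightarrow> t \<in> pair_box (l3, h3, l4, h4) \<Longrightarrow> Q (series s t) = 0"
    and G: "supported (l1 + l3) (h1 + h3) G1" "supported (min (l1 + l4) (l2 + l3)) (h1 + h4) G2"
    and bounds: "l1 \<le> h1" "l3 \<le> h3" "l2 \<le> h2" "l4 \<le> h4"
      "l2 + h1 \<le> h2 + l1 + 1" "l4 + h1 \<le> h2 + l3 + 1"
      "l2 + h3 \<le> h4 + l1 + 1" "l4 + h3 \<le> h4 + l3 + 1"
  shows "Q (G1, G2) = 0"
proof -
  have le: "l1 + l3 \<le> h1 + h3" using bounds by simp
  define w where "w = h1 + h3 - (l1 + l3)"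
  obtain g1 where g1: "G1 = monom 1 (l1 + l3) * g1" "degree g1 + (l1 + l3) \<le> h1 + h3"
    using supported_obtain[OF G(1) le] by blast
  have curve: "poly_curve (\<lambda>z. monom 1 (l1 + l3) * (g1 + monom (1 * z) w))"
    by (intro poly_curve_mult poly_curve_const poly_curve_add poly_curve_monom)
  have zero': "Q (monom 1 (l1 + l3) * (g1 + monom (1 * z) w), G2) = 0" if "z \<notin> {- coeff g1 w}" for z
  proof (rule vanish_if_top_coefficient_nonzero[OF Q zero refl _ _ G(2) bounds])
    have top: "coeff (g1 + monom (1 * z) w) w \<noteq> 0" using that by (auto simp: add_eq_0_iff)
    then show "g1 + monom (1 * z) w \<noteq> 0" by (metis coeff_0)
    have "degree (g1 + monom (1 * z) w) \<le> w"
      using g1(2) le by (intro degree_add_le degree_monom_le) (simp add: w_def)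
    moreover have "w \<le> degree (g1 + monom (1 * z) w)" using top by (rule le_degree)
    ultimately show "degree (g1 + monom (1 * z) w) + l1 + l3 = h1 + h3"
      using le by (simp add: w_def)
  qed
  have "Q (monom 1 (l1 + l3) * (g1 + monom (1 * 0) w), G2) = 0"
    by (rule polyfun_zero_at_end_of_curve[OF Q curve poly_curve_const finite.insertI[OF finite.emptyI] zero'])
  then show ?thesis by (simp add: g1(1))
qed

text \<open>
  Series combinations of arbitrary pairs within the exponent bounds are Zariski dense among the pairs
  within the bounds of the combination. Since the connection is commutative, it is enough to treat
  one order of the two upper ends \<open>h1 + h4\<close> and \<open>h2 + h3\<close>.
\<close>

lemma vanish_on_series_bounds:
  assumes Q: "polyfun Q"
    and zero: "\<And>s t. s \<in> pair_box (l1, h1, l2, h2) \<Longrightarrow> t \<in> pair_box (l3, h3, l4, h4) \<Longrightarrow> Q (series s t) = 0"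
    and G: "G \<in> pair_box (l1 + l3, h1 + h3, min (l1 + l4) (l2 + l3), max (h1 + h4) (h2 + h3))"
    and bounds: "l1 \<le> h1" "l3 \<le> h3" "l2 \<le> h2" "l4 \<le> h4"
      "l2 + h1 \<le> h2 + l1 + 1" "l4 + h1 \<le> h2 + l3 + 1"
      "l2 + h3 \<le> h4 + l1 + 1" "l4 + h3 \<le> h4 + l3 + 1"
  shows "Q G = 0"
proof -
  obtain G1 G2 where GG: "G = (G1, G2)" "supported (l1 + l3) (h1 + h3) G1"
    "supported (min (l1 + l4) (l2 + l3)) (max (h1 + h4) (h2 + h3)) G2"
    using G by (auto simp: pair_box_def)
  show ?thesis
  proof (cases "h2 + h3 \<le> h1 + h4")
    case True
    then show ?thesis unfolding GG(1)
      using vanish_if_second_dominates[OF Q zero GG(2) _ bounds] GG(3) by (simp add: max_def)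
  next
    case False
    have zero': "Q (series s t) = 0"
      if "s \<in> pair_box (l3, h3, l4, h4)" "t \<in> pair_box (l1, h1, l2, h2)" for s t
      using zero[OF that(2,1)] by (simp add: series_commute)
    have "Q (G1, G2) = 0"
    proof (rule vanish_if_second_dominates[OF Q zero'])
      show "supported (l3 + l1) (h3 + h1) G1" using GG(2) by (simp add: add.commute)
      show "supported (min (l3 + l2) (l4 + l1)) (h3 + h2) G2"
        using GG(3) False by (simp add: add.commute min.commute max_def)
    qed (use bounds in auto)
    then show ?thesis by (simp add: GG(1))
  qed
qed

section \<open>The RL form of a network\<close>

text \<open>
  The equation of the network in which the elements with a component in \<open>T\<close> become inductors and all
  others resistors, over an arbitrary ring of parameter values. Taken over the polynomial ring with
  \<open>v = mvar\<close> it has the generic coefficients, and taken over \<open>\<complex>\<close> their values.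
\<close>

fun rl_equation :: "component set \<Rightarrow> (nat \<Rightarrow> 'a::comm_ring_1) \<Rightarrow> nat \<Rightarrow> network \<Rightarrow> 'a poly \<times> 'a poly" where
  "rl_equation T v k (Base c) = ([:1:], if c \<in> T then [:0, v k:] else [:v k:])"
| "rl_equation T v k (Series N1 N2) =
     series (rl_equation T v k N1) (rl_equation T v (k + num_params N1) N2)"
| "rl_equation T v k (Parallel N1 N2) =
     prod.swap (series (prod.swap (rl_equation T v k N1))
       (prod.swap (rl_equation T v (k + num_params N1) N2)))"

text \<open>
  Distinct elements carry distinct parameters, so the two parts of a connection can be given their
  parameter values separately.
\<close>

lemma rl_equation_cong:
  "(\<And>i. k \<le> i \<Longrightarrow> i < k + num_params N \<Longrightarrow> v i = w i) \<Longrightarrow> rl_equation T v k N = rl_equation T w k N"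
proof (induction N arbitrary: k)
  case (Series N1 N2)
  have "rl_equation T v k N1 = rl_equation T w k N1"
    "rl_equation T v (k + num_params N1) N2 = rl_equation T w (k + num_params N1) N2"
    by (auto intro!: Series)
  then show ?case by simp
next
  case (Parallel N1 N2)
  have "rl_equation T v k N1 = rl_equation T w k N1"
    "rl_equation T v (k + num_params N1) N2 = rl_equation T w (k + num_params N1) N2"
    by (auto intro!: Parallel)
  then show ?case by simp
qed simp

definition scale :: "'a::comm_ring_1 \<Rightarrow> 'a poly \<times> 'a poly \<Rightarrow> 'a poly \<times> 'a poly" where
  "scale c s = (smult c (fst s), smult c (snd s))"

lemma coord_scale [simp]: "coord j (scale c s) = c * coord j s"
  by (cases "(j, s)" rule: coord.cases) (auto simp: scale_def)

lemma series_scale: "series (scale a s) (scale b t) = scale (a * b) (series s t)"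
  by (simp add: series_def scale_def smult_add_right mult.commute)

lemma swap_scale: "prod.swap (scale a s) = scale a (prod.swap s)"
  by (simp add: scale_def)

lemma aeval_coord_rl_equation:
  "aeval x (coord j (rl_equation T v k N)) = coord j (rl_equation T (\<lambda>i. aeval x (v i)) k N)"
proof -
  have "(\<forall>i. aeval x (coeff (fst (rl_equation T v k N)) i) = coeff (fst (rl_equation T (\<lambda>i. aeval x (v i)) k N)) i) \<and>
    (\<forall>i. aeval x (coeff (snd (rl_equation T v k N)) i) = coeff (snd (rl_equation T (\<lambda>i. aeval x (v i)) k N)) i)"
    by (induction N arbitrary: k)
       (auto simp: series_def coeff_mult aeval_simps coeff_pCons split: nat.splits)
  then show ?thesis by (cases "(j, rl_equation T v k N)" rule: coord.cases) auto
qed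

type_synonym exponent_bounds = "nat \<times> nat \<times> nat \<times> nat"

fun series_bounds :: "exponent_bounds \<Rightarrow> exponent_bounds \<Rightarrow> exponent_bounds" where
  "series_bounds (l1, h1, l2, h2) (l3, h3, l4, h4) =
     (l1 + l3, h1 + h3, min (l1 + l4) (l2 + l3), max (h1 + h4) (h2 + h3))"

fun swap_bounds :: "exponent_bounds \<Rightarrow> exponent_bounds" where
  "swap_bounds (l1, h1, l2, h2) = (l2, h2, l1, h1)"

text \<open>
  The ends of the two exponent intervals of \<open>rl_equation\<close>. The cancellation-free bounds turn out to be
  exact (\<open>rl_coefficients_nonzero_iff\<close>).
\<close>

fun rl_bounds :: "component set \<Rightarrow> network \<Rightarrow> exponent_bounds" where
  "rl_bounds T (Base c) = (0, 0, if c \<in> T then (1, 1) else (0, 0))"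
| "rl_bounds T (Series N1 N2) = series_bounds (rl_bounds T N1) (rl_bounds T N2)"
| "rl_bounds T (Parallel N1 N2) =
     swap_bounds (series_bounds (swap_bounds (rl_bounds T N1)) (swap_bounds (rl_bounds T N2)))"

text \<open>
  The lower ends of the two sides differ by \<open>0\<close> or \<open>1\<close>, and so do the upper ends: the impedance of an RL
  network is asymptotically that of a resistor or of an inductor, for low and for high frequencies.
\<close>

fun admissible :: "exponent_bounds \<Rightarrow> bool" where
  "admissible (l1, h1, l2, h2) \<longleftrightarrow>
     l1 \<le> h1 \<and> l2 \<le> h2 \<and> l1 \<le> l2 \<and> l2 \<le> l1 + 1 \<and> h1 \<le> h2 \<and> h2 \<le> h1 + 1"

fun num_positions :: "exponent_bounds \<Rightarrow> nat" where
  "num_positions (l1, h1, l2, h2) = (h1 - l1 + 1) + (h2 - l2 + 1)"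

lemma admissible_rl_bounds: "admissible (rl_bounds T N)"
proof (induction N)
  case (Series N1 N2)
  obtain a b c d a' b' c' d' where "rl_bounds T N1 = (a, b, c, d)" "rl_bounds T N2 = (a', b', c', d')"
    by (metis surj_pair)
  with Series show ?case by (auto simp: min_def max_def)
next
  case (Parallel N1 N2)
  obtain a b c d a' b' c' d' where "rl_bounds T N1 = (a, b, c, d)" "rl_bounds T N2 = (a', b', c', d')"
    by (metis surj_pair)
  with Parallel show ?case by (auto simp: min_def max_def)
qed simp

text \<open>
  For a series or parallel connection the number of positions minus one is at most the sum of the
  same numbers for the two parts. The difference depends only on the four differences of ends, each
  of which is \<open>0\<close> or \<open>1\<close>.
\<close>

lemma num_positions_le: "num_positions (rl_bounds T N) \<le> num_params N + 1"
proof (induction N)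
  case (Series N1 N2)
  obtain a b c d a' b' c' d' where *: "rl_bounds T N1 = (a, b, c, d)" "rl_bounds T N2 = (a', b', c', d')"
    by (metis surj_pair)
  have "admissible (a, b, c, d)" "admissible (a', b', c', d')"
    using admissible_rl_bounds[of T N1] admissible_rl_bounds[of T N2] * by simp_all
  with Series * show ?case by (auto simp: min_def max_def)
next
  case (Parallel N1 N2)
  obtain a b c d a' b' c' d' where *: "rl_bounds T N1 = (a, b, c, d)" "rl_bounds T N2 = (a', b', c', d')"
    by (metis surj_pair)
  have "admissible (a, b, c, d)" "admissible (a', b', c', d')"
    using admissible_rl_bounds[of T N1] admissible_rl_bounds[of T N2] * by simp_all
  with Parallel * show ?case by (auto simp: min_def max_def)
qed simp

fun positions :: "exponent_bounds \<Rightarrow> (side \<times> nat) set" where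
  "positions (l1, h1, l2, h2) = {Voltage} \<times> {l1..h1} \<union> {Current} \<times> {l2..h2}"

lemma finite_positions [simp]: "finite (positions B)"
  by (cases B) auto

lemma card_positions: "admissible B \<Longrightarrow> card (positions B) = num_positions B"
  by (cases B) (subst positions.simps | subst card_Un_disjoint | auto simp: card_cartesian_product)+

lemma all_positions: "(\<forall>j. P j) \<longleftrightarrow> (\<forall>i. P (Voltage, i)) \<and> (\<forall>i. P (Current, i))"
proof -
  have "P (side, i)" if "\<forall>i. P (Voltage, i)" "\<forall>i. P (Current, i)" for side i
    using that by (cases side) auto
  then show ?thesis by auto
qed

lemma pair_box_iff: "s \<in> pair_box B \<longleftrightarrow> (\<forall>j. coord j s \<noteq> 0 \<longrightarrow> j \<in> positions B)"
proof -
  obtain a b c d f g where [simp]: "B = (a, b, c, d)" "s = (f, g)" by (metis surj_pair)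
  have "(\<forall>j. coord j s \<noteq> 0 \<longrightarrow> j \<in> positions B) \<longleftrightarrow>
    (\<forall>i. coord (Voltage, i) s \<noteq> 0 \<longrightarrow> (Voltage, i) \<in> positions B) \<and>
    (\<forall>i. coord (Current, i) s \<noteq> 0 \<longrightarrow> (Current, i) \<in> positions B)"
    by (rule all_positions)
  also have "\<dots> \<longleftrightarrow> s \<in> pair_box B"
    by (simp add: pair_box_def supported_def)
  finally show ?thesis by (rule sym)
qed

lemma supported_mult:
  assumes "supported l h f" "supported l' h' g"
  shows "supported (l + l') (h + h') (f * g)"
  unfolding supported_def
proof (intro allI impI)
  fix i assume "coeff (f * g) i \<noteq> 0"
  then have "\<exists>k\<le>i. coeff f k * coeff g (i - k) \<noteq> 0"
    unfolding coeff_mult by (metis (no_types, lifting) atMost_iff sum.neutral)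
  then obtain k where "k \<le> i" and nz: "coeff f k * coeff g (i - k) \<noteq> 0" by blast
  from nz have "coeff f k \<noteq> 0" "coeff g (i - k) \<noteq> 0" by auto
  with assms \<open>k \<le> i\<close> show "l + l' \<le> i \<and> i \<le> h + h'" unfolding supported_def
    by (metis add_mono le_add_diff_inverse)
qed

lemma supported_add:
  assumes "supported l h f" "supported l' h' g"
  shows "supported (min l l') (max h h') (f + g)"
  using assms unfolding supported_def by (metis add_0 coeff_add max.coboundedI1 max.coboundedI2 min.coboundedI1 min.coboundedI2)

lemma rl_equation_supported:
  "case rl_bounds T N of (l1, h1, l2, h2) \<Rightarrow>
     supported l1 h1 (fst (rl_equation T v k N)) \<and> supported l2 h2 (snd (rl_equation T v k N))"
proof (induction N arbitrary: k)
  case (Base c)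
  then show ?case by (auto simp: supported_def coeff_pCons split: nat.splits)
next
  case (Series N1 N2)
  obtain a b c d a' b' c' d' where *: "rl_bounds T N1 = (a, b, c, d)" "rl_bounds T N2 = (a', b', c', d')"
    by (metis surj_pair)
  show ?case using Series[of k] Series[of "k + num_params N1"] *
    by (auto simp: series_def intro!: supported_mult supported_add)
next
  case (Parallel N1 N2)
  obtain a b c d a' b' c' d' where *: "rl_bounds T N1 = (a, b, c, d)" "rl_bounds T N2 = (a', b', c', d')"
    by (metis surj_pair)
  show ?case using Parallel[of k] Parallel[of "k + num_params N1"] *
    by (auto simp: series_def intro!: supported_mult supported_add)
qed

section \<open>The coefficient cone is Zariski dense\<close>

lemma polyfun_coeff: "polyfun (\<lambda>s. coeff (fst s) i)" "polyfun (\<lambda>s. coeff (snd s) i)"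
proof -
  have "(\<lambda>s :: complex poly \<times> complex poly. coeff (fst s) i) = coord (Voltage, i)"
    "(\<lambda>s :: complex poly \<times> complex poly. coeff (snd s) i) = coord (Current, i)"
    by (simp_all add: fun_eq_iff)
  then show "polyfun (\<lambda>s. coeff (fst s) i)" "polyfun (\<lambda>s. coeff (snd s) i)"
    by (simp_all only: polyfun_coord)
qed

lemma polyfun_coord_series: "polyfun (\<lambda>s. coord j (series s t))"
proof -
  obtain side i where "j = (side, i)" by fastforce
  then show ?thesis
    by (cases side)
       (auto simp: series_def coeff_mult intro!: polyfun_add polyfun_sum polyfun_mult polyfun_coeff polyfun_const)
qed

lemma polyfun_coord_swap: "polyfun (\<lambda>s. coord j (prod.swap s))"
proof -
  obtain side i where "j = (side, i)" by fastforce
  then show ?thesis by (cases side) (auto intro!: polyfun_coeff)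
qed

lemma polyfun_series: "polyfun Q \<Longrightarrow> polyfun (\<lambda>s. Q (series s t))"
  by (rule polyfun_compose[OF _ polyfun_coord_series])

lemma polyfun_swap: "polyfun Q \<Longrightarrow> polyfun (\<lambda>s. Q (prod.swap s))"
  by (rule polyfun_compose[OF _ polyfun_coord_swap])

lemma polyfun_parallel: "polyfun Q \<Longrightarrow> polyfun (\<lambda>s. Q (prod.swap (series (prod.swap s) t)))"
  using polyfun_swap[OF polyfun_series[OF polyfun_swap]] .

text \<open>
  The multiples by \<open>c\<close> make the set a cone and account for the fact that an equation is determined
  only up to a common factor.
\<close>

definition cone_dense :: "component set \<Rightarrow> network \<Rightarrow> bool" where
  "cone_dense T N \<longleftrightarrow> (\<forall>k Q. polyfun Q \<longrightarrow> (\<forall>c x. Q (scale c (rl_equation T x k N)) = 0) \<longrightarrow>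
     (\<forall>s \<in> pair_box (rl_bounds T N). Q s = 0))"

text \<open>
  Density passes from two sets to the image of their product under a connection: move one argument
  at a time. The scaling factors of the two parts multiply.
\<close>

lemma vanish_on_combination:
  assumes dense: "cone_dense T N1" "cone_dense T N2" and Q: "polyfun Q"
    and op: "\<And>Q t. polyfun Q \<Longrightarrow> polyfun (\<lambda>s. Q (op s t))"
      "\<And>s t. op s t = op t s" "\<And>a b s t. op (scale a s) (scale b t) = scale (a * b) (op s t)"
    and zero: "\<And>c x. Q (scale c (op (rl_equation T x k N1) (rl_equation T x (k + num_params N1) N2))) = 0"
    and s: "s \<in> pair_box (rl_bounds T N1)" and t: "t \<in> pair_box (rl_bounds T N2)"
  shows "Q (op s t) = 0"
proof -
  have "Q (op (scale a (rl_equation T x k N1)) (scale b (rl_equation T y (k + num_params N1) N2))) = 0" for a b x y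
  proof -
    define z where "z i = (if i < k + num_params N1 then x i else y i)" for i
    have "rl_equation T x k N1 = rl_equation T z k N1"
      "rl_equation T y (k + num_params N1) N2 = rl_equation T z (k + num_params N1) N2"
      by (auto simp: z_def intro!: rl_equation_cong)
    then show ?thesis using zero[of "a * b" z] by (simp add: op(3))
  qed
  then have "Q (op s (scale b (rl_equation T y (k + num_params N1) N2))) = 0" for b y
    using dense(1) op(1)[OF Q] s unfolding cone_dense_def by blast
  then have "Q (op (scale b (rl_equation T y (k + num_params N1) N2)) s) = 0" for b y
    by (simp add: op(2))
  then have "Q (op t s) = 0"
    using dense(2) op(1)[OF Q] t unfolding cone_dense_def by blast
  then show ?thesis by (simp add: op(2))
qed

lemma swap_in_pair_box: "prod.swap s \<in> pair_box (swap_bounds B) \<longleftrightarrow> s \<in> pair_box B"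
  by (cases B; cases s) (auto simp: pair_box_def)

lemma swap_bounds_swap [simp]: "swap_bounds (swap_bounds B) = B"
  by (cases B) simp

text \<open>
  The cone of an element consists of the pairs \<open>(a, a x)\<close> or \<open>(a, a x d/dt)\<close>, which misses only pairs
  with voltage side \<open>0\<close>.
\<close>

lemma cone_dense_Base: "cone_dense T (Base c)"
  unfolding cone_dense_def
proof (intro allI impI ballI)
  fix k :: nat and Q s
  assume Q: "polyfun Q" and zero: "\<forall>a x. Q (scale a (rl_equation T x k (Base c))) = 0"
    and s: "s \<in> pair_box (rl_bounds T (Base c))"
  define e :: nat where "e = (if c \<in> T then 1 else 0)"
  obtain f g where fg: "s = (f, g)" by fastforce
  have "supported 0 0 f" "supported e e g"
    using s by (auto simp: fg pair_box_def e_def split: if_splits)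
  then have f: "f = monom (coeff f 0) 0" and g: "g = monom (coeff g e) e"
    by (auto simp: poly_eq_iff supported_def)
  have "Q (monom (1 * z) 0 + f, g) = 0" if "z \<notin> {- coeff f 0}" for z
  proof -
    define a where "a = z + coeff f 0"
    have "a \<noteq> 0" using that by (auto simp: a_def add_eq_0_iff)
    then have "scale a (rl_equation T (\<lambda>_. coeff g e / a) k (Base c)) = (monom a 0, monom (coeff g e) e)"
      by (auto simp: scale_def e_def monom_0 monom_Suc)
    also have "monom a 0 = monom (1 * z) 0 + f" by (subst f) (simp add: a_def add_monom)
    also have "monom (coeff g e) e = g" by (rule g[symmetric])
    finally show ?thesis using zero by metis
  qed
  note zero' = this
  have "poly_curve (\<lambda>z. monom (1 * z) 0 + f)"
    by (intro poly_curve_add poly_curve_monom poly_curve_const)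
  from polyfun_zero_at_end_of_curve[OF Q this poly_curve_const finite.insertI[OF finite.emptyI] zero']
  have "Q (monom (1 * 0) 0 + f, g) = 0" .
  then show "Q s = 0" by (simp add: fg)
qed

lemma cone_dense: "cone_dense T N"
proof (induction N)
  case (Base c)
  show ?case by (rule cone_dense_Base)
next
  case (Series N1 N2)
  obtain l1 h1 l2 h2 l3 h3 l4 h4 where B: "rl_bounds T N1 = (l1, h1, l2, h2)" "rl_bounds T N2 = (l3, h3, l4, h4)"
    by (metis surj_pair)
  have adm: "admissible (l1, h1, l2, h2)" "admissible (l3, h3, l4, h4)"
    using admissible_rl_bounds[of T N1] admissible_rl_bounds[of T N2] B by simp_all
  show ?case unfolding cone_dense_def
  proof (intro allI impI ballI)
    fix k :: nat and Q G
    assume Q: "polyfun Q" and zero: "\<forall>c x. Q (scale c (rl_equation T x k (Series N1 N2))) = 0"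
      and G: "G \<in> pair_box (rl_bounds T (Series N1 N2))"
    have "Q (series s t) = 0" if "s \<in> pair_box (l1, h1, l2, h2)" "t \<in> pair_box (l3, h3, l4, h4)" for s t
      using vanish_on_combination[OF Series Q polyfun_series series_commute series_scale, of k s t] zero that
      by (simp add: B)
    then show "Q G = 0"
      by (rule vanish_on_series_bounds[OF Q]) (use G B adm in auto)
  qed
next
  case (Parallel N1 N2)
  obtain l1 h1 l2 h2 l3 h3 l4 h4 where B: "rl_bounds T N1 = (l1, h1, l2, h2)" "rl_bounds T N2 = (l3, h3, l4, h4)"
    by (metis surj_pair)
  have adm: "admissible (l1, h1, l2, h2)" "admissible (l3, h3, l4, h4)"
    using admissible_rl_bounds[of T N1] admissible_rl_bounds[of T N2] B by simp_all
  let ?op = "\<lambda>s t. prod.swap (series (prod.swap s) (prod.swap t))"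
  show ?case unfolding cone_dense_def
  proof (intro allI impI ballI)
    fix k :: nat and Q G
    assume Q: "polyfun Q" and zero: "\<forall>c x. Q (scale c (rl_equation T x k (Parallel N1 N2))) = 0"
      and G: "G \<in> pair_box (rl_bounds T (Parallel N1 N2))"
    have op: "?op s t = ?op t s" "?op (scale a s) (scale b t) = scale (a * b) (?op s t)"
      for s t :: "complex poly \<times> complex poly" and a b
      using series_commute[of "prod.swap s" "prod.swap t"] by (simp_all add: swap_scale series_scale)
    have comb: "Q (?op s t) = 0" if "s \<in> pair_box (rl_bounds T N1)" "t \<in> pair_box (rl_bounds T N2)" for s t
      by (rule vanish_on_combination[where op = ?op and k = k, OF Parallel Q polyfun_parallel op _ that])
         (use zero in simp_all)
    have "Q (prod.swap (series s t)) = 0" if "s \<in> pair_box (l2, h2, l1, h1)" "t \<in> pair_box (l4, h4, l3, h3)" for s t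
      using comb[of "prod.swap s" "prod.swap t"] that
        swap_in_pair_box[of s "(l2, h2, l1, h1)"] swap_in_pair_box[of t "(l4, h4, l3, h3)"] B
      by simp
    moreover have "prod.swap G \<in> pair_box (l2 + l4, h2 + h4, min (l2 + l3) (l1 + l4), max (h2 + h3) (h1 + h4))"
      using G B swap_in_pair_box[of G "rl_bounds T (Parallel N1 N2)"] by simp
    ultimately have "Q (prod.swap (prod.swap G)) = 0"
      by (rule vanish_on_series_bounds[OF polyfun_swap[OF Q]]) (use adm in auto)
    then show "Q G = 0" by simp
  qed
qed

text \<open>
  A coefficient that vanished identically would vanish on the cone, hence by density on all pairs
  within the bounds, among which there is one with coefficient \<open>1\<close> at this position.
\<close>

lemma rl_coefficients_nonzero_iff:
  "coord j (rl_equation T mvar 0 N) \<noteq> 0 \<longleftrightarrow> j \<in> positions (rl_bounds T N)"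
proof
  assume nz: "coord j (rl_equation T mvar 0 N) \<noteq> 0"
  obtain side i where ji: "j = (side, i)" by fastforce
  obtain l1 h1 l2 h2 where B: "rl_bounds T N = (l1, h1, l2, h2)" by (metis surj_pair)
  have "supported l1 h1 (fst (rl_equation T mvar 0 N))" "supported l2 h2 (snd (rl_equation T mvar 0 N))"
    using rl_equation_supported[where T = T and N = N and v = mvar and k = 0] unfolding B by simp_all
  then show "j \<in> positions (rl_bounds T N)"
    using nz unfolding B ji supported_def by (cases side) auto
next
  assume j: "j \<in> positions (rl_bounds T N)"
  show "coord j (rl_equation T mvar 0 N) \<noteq> 0"
  proof
    assume 0: "coord j (rl_equation T mvar 0 N) = 0"
    have "coord j (scale c (rl_equation T x 0 N)) = 0" for c and x :: "nat \<Rightarrow> complex"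
      using aeval_coord_rl_equation[where x = x and v = mvar and k = 0 and T = T and N = N and j = j] 0
      by simp
    then have zero: "coord j s = 0" if "s \<in> pair_box (rl_bounds T N)" for s
      using cone_dense[of T N] polyfun_coord[of j] that unfolding cone_dense_def by blast
    obtain side i where ji: "j = (side, i)" by fastforce
    define s :: "complex poly \<times> complex poly"
      where "s = (if side = Voltage then (monom 1 i, 0) else (0, monom 1 i))"
    have "coord j s = 1" by (cases side) (auto simp: s_def ji)
    moreover have "s \<in> pair_box (rl_bounds T N)"
      using j by (cases side; cases "rl_bounds T N") (auto simp: s_def ji pair_box_def supported_def)
    ultimately show False using zero by auto
  qed
qed

section \<open>Reduction of a network with two types of components\<close>

lemma coeff_pcompose_monom:
  fixes p :: "'a::comm_ring_1 poly"
  assumes "r > 0"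
  shows "coeff (p \<circ>\<^sub>p monom 1 r) i = (if r dvd i then coeff p (i div r) else 0)"
proof (induction p arbitrary: i)
  case 0
  then show ?case by simp
next
  case (pCons a p)
  have eq: "coeff (pCons a p \<circ>\<^sub>p monom 1 r) i =
      (if i = 0 then a else 0) + (if i < r then 0 else coeff (p \<circ>\<^sub>p monom 1 r) (i - r))"
    by (auto simp: pcompose_pCons coeff_monom_mult coeff_pCons split: nat.splits)
  show ?case
  proof (cases "i < r")
    case True
    then show ?thesis unfolding eq using assms by (auto dest: dvd_imp_le)
  next
    case False
    then have "i div r = Suc ((i - r) div r)" "r dvd i - r \<longleftrightarrow> r dvd i"
      using assms by (auto simp: le_div_geq dvd_minus_self)
    with False assms show ?thesis unfolding eq pCons.IH by auto
  qed
qed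

text \<open>
  Substitution of a power and multiplication by powers of the indeterminate only move the nonzero
  coefficients.
\<close>

lemma coeff_bijection:
  fixes F L :: "'a::comm_ring_1 poly"
  assumes "r > 0" and eq: "monom 1 a * F = monom 1 u * (L \<circ>\<^sub>p monom 1 r)"
  shows "\<exists>\<pi>. bij_betw \<pi> {i. coeff F i \<noteq> 0} {i. coeff L i \<noteq> 0} \<and>
           (\<forall>i. coeff F i \<noteq> 0 \<longrightarrow> coeff L (\<pi> i) = coeff F i)"
proof -
  have F: "coeff F i = (if u \<le> i + a \<and> r dvd (i + a - u) then coeff L ((i + a - u) div r) else 0)" for i
    using arg_cong[OF eq, of "\<lambda>p. coeff p (i + a)"] \<open>r > 0\<close>
    by (auto simp: coeff_monom_mult coeff_pcompose_monom split: if_splits)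
  have L: "a \<le> u + r * m \<and> coeff F (u + r * m - a) = coeff L m" if "coeff L m \<noteq> 0" for m
    using arg_cong[OF eq, of "\<lambda>p. coeff p (u + r * m)"] \<open>r > 0\<close> that
    by (auto simp: coeff_monom_mult coeff_pcompose_monom split: if_splits)
  define \<pi> where "\<pi> i = (i + a - u) div r" for i
  have "bij_betw \<pi> {i. coeff F i \<noteq> 0} {i. coeff L i \<noteq> 0}"
  proof (rule bij_betwI[where g = "\<lambda>m. u + r * m - a"])
    show "\<pi> \<in> {i. coeff F i \<noteq> 0} \<rightarrow> {i. coeff L i \<noteq> 0}"
      by (auto simp: F \<pi>_def split: if_splits)
    show "(\<lambda>m. u + r * m - a) \<in> {i. coeff L i \<noteq> 0} \<rightarrow> {i. coeff F i \<noteq> 0}"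
      using L by auto
    show "u + r * \<pi> i - a = i" if "i \<in> {i. coeff F i \<noteq> 0}" for i
      using that by (auto simp: F \<pi>_def split: if_splits)
    show "\<pi> (u + r * m - a) = m" if "m \<in> {i. coeff L i \<noteq> 0}" for m
      using L[of m] that \<open>r > 0\<close> by (auto simp: \<pi>_def)
  qed
  moreover have "coeff L (\<pi> i) = coeff F i" if "coeff F i \<noteq> 0" for i
    using that by (auto simp: F \<pi>_def split: if_splits)
  ultimately show ?thesis by blast
qed

text \<open>
  The equation \<open>s\<close> arises from \<open>t\<close> by substituting the power \<open>r\<close> of \<open>d/dt\<close>, up to a common power of
  \<open>d/dt\<close> and a further power \<open>d\<close> between the two sides. The shifts can have negative exponents and are
  therefore written as multiplications of both members. Fixing \<open>d\<close> for the whole network makes the relation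
  compatible with both connections.
\<close>

definition rl_related :: "nat \<Rightarrow> nat \<Rightarrow> 'a::comm_ring_1 poly \<times> 'a poly \<Rightarrow> 'a poly \<times> 'a poly \<Rightarrow> bool" where
  "rl_related r d s t \<longleftrightarrow> (\<exists>a u. monom 1 a * fst s = monom 1 u * (fst t \<circ>\<^sub>p monom 1 r) \<and>
     monom 1 (a + d) * snd s = monom 1 u * (snd t \<circ>\<^sub>p monom 1 r))"

lemma monom_1_add: "monom 1 (a + b) = (monom 1 a * monom 1 b :: 'a::comm_ring_1 poly)"
  by (simp add: mult_monom)

lemma rl_related_series:
  assumes "rl_related r d s t" "rl_related r d s' t'"
  shows "rl_related r d (series s s') (series t t')"
    and "rl_related r d (prod.swap (series (prod.swap s) (prod.swap s')))
           (prod.swap (series (prod.swap t) (prod.swap t')))"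
proof -
  let ?S = "\<lambda>p. p \<circ>\<^sub>p monom 1 r"
  obtain a u where 1: "monom 1 a * fst s = monom 1 u * ?S (fst t)"
    "monom 1 (a + d) * snd s = monom 1 u * ?S (snd t)"
    using assms(1) unfolding rl_related_def by blast
  obtain b w where 2: "monom 1 b * fst s' = monom 1 w * ?S (fst t')"
    "monom 1 (b + d) * snd s' = monom 1 w * ?S (snd t')"
    using assms(2) unfolding rl_related_def by blast
  have ff: "monom 1 (a + b) * (fst s * fst s') = monom 1 (u + w) * ?S (fst t * fst t')"
  proof -
    have "monom 1 (a + b) * (fst s * fst s') = (monom 1 a * fst s) * (monom 1 b * fst s')"
      by (simp only: monom_1_add mult_ac)
    then show ?thesis unfolding 1 2 by (simp only: monom_1_add pcompose_mult mult_ac)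
  qed
  have fs: "monom 1 (a + b + d) * (fst s * snd s' + snd s * fst s') =
      monom 1 (u + w) * ?S (fst t * snd t' + snd t * fst t')"
  proof -
    have "monom 1 (a + b + d) * (fst s * snd s' + snd s * fst s') =
        (monom 1 a * fst s) * (monom 1 (b + d) * snd s') + (monom 1 (a + d) * snd s) * (monom 1 b * fst s')"
      by (simp only: monom_1_add mult_ac distrib_left)
    then show ?thesis unfolding 1 2
      by (simp only: monom_1_add pcompose_mult pcompose_add mult_ac distrib_left)
  qed
  have ss: "monom 1 (a + b + d + d) * (snd s * snd s') = monom 1 (u + w) * ?S (snd t * snd t')"
  proof -
    have "monom 1 (a + b + d + d) * (snd s * snd s') = (monom 1 (a + d) * snd s) * (monom 1 (b + d) * snd s')"
      by (simp only: monom_1_add mult_ac)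
    then show ?thesis unfolding 1 2 by (simp only: monom_1_add pcompose_mult mult_ac)
  qed
  show "rl_related r d (series s s') (series t t')"
    unfolding rl_related_def series_def using ff fs
    by (intro exI[of _ "a + b"] exI[of _ "u + w"]) simp
  show "rl_related r d (prod.swap (series (prod.swap s) (prod.swap s')))
           (prod.swap (series (prod.swap t) (prod.swap t')))"
    unfolding rl_related_def series_def using fs ss
    by (intro exI[of _ "a + b + d"] exI[of _ "u + w"]) (simp add: add.commute)
qed

lemma equation_from_combinations:
  "equation_from k (Series N1 N2) = series (equation_from k N1) (equation_from (k + num_params N1) N2)"
  "equation_from k (Parallel N1 N2) = prod.swap (series (prod.swap (equation_from k N1))
     (prod.swap (equation_from (k + num_params N1) N2)))"
  by (simp_all add: series_def case_prod_unfold Let_def add.commute)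

lemma rl_related_equation_from:
  assumes "\<And>c k. c \<in> components N \<Longrightarrow>
    rl_related r d (base_equation c (mvar k)) (rl_equation T mvar k (Base c))"
  shows "rl_related r d (equation_from k N) (rl_equation T mvar k N)"
  using assms
proof (induction N arbitrary: k)
  case (Series N1 N2)
  then show ?case
    unfolding equation_from_combinations rl_equation.simps by (intro rl_related_series) simp_all
next
  case (Parallel N1 N2)
  then show ?case
    unfolding equation_from_combinations rl_equation.simps by (intro rl_related_series) simp_all
qed simp

text \<open>
  Inductors and capacitors: \<open>d/dt\<close> times the impedance is \<open>L (d/dt)\<^sup>2\<close> or \<open>C\<close>, so \<open>r = 2\<close> and \<open>d = 1\<close>.
  Inductors and resistors are already in the right form. Resistors and capacitors: \<open>d/dt\<close> times the
  impedance is \<open>R d/dt\<close> or \<open>C\<close>, so \<open>d = 1\<close> and the resistors take the role of inductors.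
\<close>

lemma two_types_rl_related:
  assumes "components N \<subseteq> {Inductor, Capacitor} \<or> components N \<subseteq> {Inductor, Resistor} \<or>
      components N \<subseteq> {Capacitor, Resistor}"
  shows "\<exists>T r d. r > 0 \<and> rl_related r d (constitutive_equation N) (rl_equation T mvar 0 N)"
proof -
  have witness: "rl_related r d s t"
    if "monom 1 a * fst s = monom 1 u * (fst t \<circ>\<^sub>p monom 1 r)"
      "monom 1 (a + d) * snd s = monom 1 u * (snd t \<circ>\<^sub>p monom 1 r)"
    for a u r d and s t :: "mpoly poly \<times> mpoly poly"
    using that unfolding rl_related_def by blast
  consider "components N \<subseteq> {Inductor, Capacitor}" | "components N \<subseteq> {Inductor, Resistor}"
    | "components N \<subseteq> {Capacitor, Resistor}" using assms by blast
  then show ?thesis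
  proof cases
    case 1
    have "rl_related 2 1 (base_equation Inductor (mvar k)) (rl_equation {Inductor} mvar k (Base Inductor))"
      "rl_related 2 1 (base_equation Capacitor (mvar k)) (rl_equation {Inductor} mvar k (Base Capacitor))" for k
      by (rule witness[of 0 _ 0]; simp add: monom_Suc monom_0 pcompose_pCons numeral_2_eq_2 one_pCons)
         (rule witness[of 0 _ 1]; simp add: monom_Suc monom_0 pcompose_pCons numeral_2_eq_2 one_pCons)
    then have "rl_related 2 1 (equation_from 0 N) (rl_equation {Inductor} mvar 0 N)"
      using 1 by (intro rl_related_equation_from) auto
    then show ?thesis unfolding constitutive_equation_def by (metis zero_less_numeral)
  next
    case 2
    have "rl_related 1 0 (base_equation Inductor (mvar k)) (rl_equation {Inductor} mvar k (Base Inductor))"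
      "rl_related 1 0 (base_equation Resistor (mvar k)) (rl_equation {Inductor} mvar k (Base Resistor))" for k
      by (rule witness[of 0 _ 0]; simp add: monom_Suc monom_0 pcompose_pCons one_pCons)+
    then have "rl_related 1 0 (equation_from 0 N) (rl_equation {Inductor} mvar 0 N)"
      using 2 by (intro rl_related_equation_from) auto
    then show ?thesis unfolding constitutive_equation_def by (metis zero_less_one)
  next
    case 3
    have "rl_related 1 1 (base_equation Resistor (mvar k)) (rl_equation {Resistor} mvar k (Base Resistor))"
      "rl_related 1 1 (base_equation Capacitor (mvar k)) (rl_equation {Resistor} mvar k (Base Capacitor))" for k
      by (rule witness[of 0 _ 0]; simp add: monom_Suc monom_0 pcompose_pCons one_pCons)
         (rule witness[of 0 _ 1]; simp add: monom_Suc monom_0 pcompose_pCons one_pCons)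
    then have "rl_related 1 1 (equation_from 0 N) (rl_equation {Resistor} mvar 0 N)"
      using 3 by (intro rl_related_equation_from) auto
    then show ?thesis unfolding constitutive_equation_def by (metis zero_less_one)
  qed
qed

lemma eq_coeff_eq_coord: "eq_coeff N j = coord j (constitutive_equation N)"
  by (cases "(N, j)" rule: eq_coeff.cases) auto

lemma two_types_coefficients:
  assumes "components N \<subseteq> {Inductor, Capacitor} \<or> components N \<subseteq> {Inductor, Resistor} \<or>
      components N \<subseteq> {Capacitor, Resistor}"
  shows "\<exists>T \<pi>. bij_betw \<pi> (nonzero_coeffs N) {j. coord j (rl_equation T mvar 0 N) \<noteq> 0} \<and>
    (\<forall>j\<in>nonzero_coeffs N. coord (\<pi> j) (rl_equation T mvar 0 N) = eq_coeff N j)"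
proof -
  obtain T r d where "r > 0" and rel: "rl_related r d (constitutive_equation N) (rl_equation T mvar 0 N)"
    using two_types_rl_related[OF assms] by blast
  define F where "F = constitutive_equation N"
  define L where "L = rl_equation T mvar 0 N"
  obtain a u where "monom 1 a * fst F = monom 1 u * (fst L \<circ>\<^sub>p monom 1 r)"
    "monom 1 (a + d) * snd F = monom 1 u * (snd L \<circ>\<^sub>p monom 1 r)"
    using rel unfolding rl_related_def F_def L_def by blast
  from this[THEN coeff_bijection[OF \<open>r > 0\<close>]]
  obtain \<pi>1 \<pi>2 where \<pi>1: "bij_betw \<pi>1 {i. coeff (fst F) i \<noteq> 0} {i. coeff (fst L) i \<noteq> 0}"
      "\<And>i. coeff (fst F) i \<noteq> 0 \<Longrightarrow> coeff (fst L) (\<pi>1 i) = coeff (fst F) i"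
    and \<pi>2: "bij_betw \<pi>2 {i. coeff (snd F) i \<noteq> 0} {i. coeff (snd L) i \<noteq> 0}"
      "\<And>i. coeff (snd F) i \<noteq> 0 \<Longrightarrow> coeff (snd L) (\<pi>2 i) = coeff (snd F) i"
    by blast
  define \<pi> where "\<pi> = (\<lambda>(side, i). (side, if side = Voltage then \<pi>1 i else \<pi>2 i))"
  have coord_\<pi>: "coord (\<pi> j) L = coord j F" if "coord j F \<noteq> 0" for j
  proof -
    obtain side i where "j = (side, i)" by fastforce
    with that \<pi>1(2) \<pi>2(2) show ?thesis by (cases side) (auto simp: \<pi>_def)
  qed
  have "bij_betw \<pi> {j. coord j F \<noteq> 0} {j. coord j L \<noteq> 0}"
  proof (rule bij_betw_imageI)
    show "inj_on \<pi> {j. coord j F \<noteq> 0}"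
    proof (rule inj_onI)
      fix j j' assume *: "j \<in> {j. coord j F \<noteq> 0}" "j' \<in> {j. coord j F \<noteq> 0}" "\<pi> j = \<pi> j'"
      obtain side i side' i' where "j = (side, i)" "j' = (side', i')" by fastforce
      with * show "j = j'"
        using \<pi>1(1) \<pi>2(1) by (cases side; cases side') (auto simp: \<pi>_def bij_betw_def dest: inj_onD)
    qed
    show "\<pi> ` {j. coord j F \<noteq> 0} = {j. coord j L \<noteq> 0}"
    proof (intro equalityI subsetI)
      fix j assume "j \<in> \<pi> ` {j. coord j F \<noteq> 0}"
      then show "j \<in> {j. coord j L \<noteq> 0}" using coord_\<pi> by auto
    next
      fix j assume j: "j \<in> {j. coord j L \<noteq> 0}"
      obtain side i where ji: "j = (side, i)" by fastforce
      show "j \<in> \<pi> ` {j. coord j F \<noteq> 0}"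
      proof (cases side)
        case Voltage
        then have "i \<in> \<pi>1 ` {i. coeff (fst F) i \<noteq> 0}" using j \<pi>1(1) by (simp add: ji bij_betw_def)
        then obtain i' where "coeff (fst F) i' \<noteq> 0" "i = \<pi>1 i'" by auto
        then show ?thesis using Voltage by (intro image_eqI[of _ _ "(Voltage, i')"]) (auto simp: ji \<pi>_def)
      next
        case Current
        then have "i \<in> \<pi>2 ` {i. coeff (snd F) i \<noteq> 0}" using j \<pi>2(1) by (simp add: ji bij_betw_def)
        then obtain i' where "coeff (snd F) i' \<noteq> 0" "i = \<pi>2 i'" by auto
        then show ?thesis using Current by (intro image_eqI[of _ _ "(Current, i')"]) (auto simp: ji \<pi>_def)
      qed
    qed
  qed
  with coord_\<pi> show ?thesis
    unfolding nonzero_coeffs_def eq_coeff_eq_coord F_def L_def by blast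
qed

section \<open>Finite fibres of algebraically independent functions\<close>

text \<open>
  A bound on the exponent of each variable separately. It adds up under multiplication, and there are
  \<open>(m + 1) ^ n\<close> monomials in \<open>n\<close> variables that meet the bound \<open>m\<close>.
\<close>

definition exponents_le :: "nat \<Rightarrow> mpoly \<Rightarrow> bool" where
  "exponents_le m g \<longleftrightarrow> (\<forall>a\<in>Poly_Mapping.keys g. \<forall>i. Poly_Mapping.lookup a i \<le> m)"

lemma exponents_le_mono: "exponents_le m g \<Longrightarrow> m \<le> m' \<Longrightarrow> exponents_le m' g"
  by (meson exponents_le_def order_trans)

lemma exponents_le_mult:
  assumes "exponents_le m g" "exponents_le m' h"
  shows "exponents_le (m + m') (g * h)"
  unfolding exponents_le_def
proof (intro ballI allI)
  fix a i assume "a \<in> Poly_Mapping.keys (g * h)"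
  with keys_mult[of g h] obtain b c where "a = b + c" "b \<in> Poly_Mapping.keys g"
    "c \<in> Poly_Mapping.keys h" by auto
  with assms show "Poly_Mapping.lookup a i \<le> m + m'"
    by (auto simp: exponents_le_def lookup_add intro!: add_mono)
qed

lemma exponents_le_one: "exponents_le 0 1"
  by (simp add: exponents_le_def single_one[symmetric] del: single_one)

lemma exponents_le_power: "exponents_le m g \<Longrightarrow> exponents_le (m * k) (g ^ k)"
  by (induction k) (auto intro: exponents_le_one exponents_le_mult)

lemma exponents_le_prod:
  "finite S \<Longrightarrow> (\<And>s. s \<in> S \<Longrightarrow> exponents_le (m s) (f s)) \<Longrightarrow> exponents_le (sum m S) (prod f S)"
  by (induction S rule: finite_induct) (auto intro: exponents_le_one exponents_le_mult)

lemma exponents_le_mvar: "exponents_le 1 (mvar i)"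
  by (simp add: exponents_le_def mvar_def lookup_single when_def)

lemma exponents_le_exists: "\<exists>m. exponents_le m g"
proof -
  define V where "V = (\<Union>a\<in>Poly_Mapping.keys g. Poly_Mapping.lookup a ` Poly_Mapping.keys a)"
  have "finite V" by (simp add: V_def)
  have "Poly_Mapping.lookup a i \<le> Max (insert 0 V)" if "a \<in> Poly_Mapping.keys g" for a i
  proof (cases "i \<in> Poly_Mapping.keys a")
    case True
    then show ?thesis using that \<open>finite V\<close> by (intro Max_ge) (auto simp: V_def)
  qed (use \<open>finite V\<close> in \<open>simp add: in_keys_iff\<close>)
  then show ?thesis unfolding exponents_le_def by blast
qed

definition bounded_monomials :: "nat \<Rightarrow> nat \<Rightarrow> (nat \<Rightarrow>\<^sub>0 nat) set" where
  "bounded_monomials n m = {a. Poly_Mapping.keys a \<subseteq> {..<n} \<and> (\<forall>i. Poly_Mapping.lookup a i \<le> m)}"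

lemma card_bounded_monomials:
  shows "finite (bounded_monomials n m)" and "card (bounded_monomials n m) \<le> (m + 1) ^ n"
proof -
  let ?r = "\<lambda>a. restrict (Poly_Mapping.lookup a) {..<n}"
  have inj: "inj_on ?r (bounded_monomials n m)"
  proof (rule inj_onI)
    fix a b assume ab: "a \<in> bounded_monomials n m" "b \<in> bounded_monomials n m" "?r a = ?r b"
    show "a = b"
    proof (rule poly_mapping_eqI)
      fix i show "Poly_Mapping.lookup a i = Poly_Mapping.lookup b i"
      proof (cases "i < n")
        case True
        then show ?thesis using fun_cong[OF ab(3), of i] by simp
      next
        case False
        then have "i \<notin> Poly_Mapping.keys a" "i \<notin> Poly_Mapping.keys b"
          using ab by (auto simp: bounded_monomials_def)
        then show ?thesis by (simp add: in_keys_iff)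
      qed
    qed
  qed
  have sub: "?r ` bounded_monomials n m \<subseteq> {..<n} \<rightarrow>\<^sub>E {..m}"
    by (auto simp: bounded_monomials_def split: if_splits)
  have fin: "finite ({..<n} \<rightarrow>\<^sub>E {..m})" by (simp add: finite_PiE)
  show "finite (bounded_monomials n m)" using inj_on_finite[OF inj sub fin] .
  show "card (bounded_monomials n m) \<le> (m + 1) ^ n"
    using card_inj_on_le[OF inj sub fin] by (simp add: card_PiE)
qed

lemma lookup_const_mult: "Poly_Mapping.lookup (Poly_Mapping.single 0 c * g) a = c * Poly_Mapping.lookup g a"
  for g :: mpoly
proof -
  have "Poly_Mapping.single 0 c * g = Poly_Mapping.single 0 c *
      (\<Sum>b\<in>Poly_Mapping.keys g. Poly_Mapping.single b (Poly_Mapping.lookup g b))"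
    by (simp add: sum_singles)
  also have "\<dots> = (\<Sum>b\<in>Poly_Mapping.keys g. Poly_Mapping.single b (c * Poly_Mapping.lookup g b))"
    by (simp add: sum_distrib_left mult_single)
  finally show ?thesis
    by (auto simp: lookup_sum lookup_single when_def in_keys_iff)
qed

lemma linear_relation:
  fixes f :: "'u \<Rightarrow> mpoly"
  assumes "finite U" "(m + 1) ^ n < card U"
    and "\<And>u. u \<in> U \<Longrightarrow> mvars (f u) \<subseteq> {..<n}" "\<And>u. u \<in> U \<Longrightarrow> exponents_le m (f u)"
  shows "\<exists>v. (\<exists>u\<in>U. v u \<noteq> 0) \<and> (\<Sum>u\<in>U. Poly_Mapping.single 0 (v u) * f u) = 0"
proof -
  have "card (bounded_monomials n m) < card U"
    using card_bounded_monomials(2)[of n m] assms(2) by linarith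
  then obtain v where v: "\<exists>u\<in>U. v u \<noteq> 0"
    "\<And>a. a \<in> bounded_monomials n m \<Longrightarrow> (\<Sum>u\<in>U. Poly_Mapping.lookup (f u) a * v u) = 0"
    using kernel_vector_in_subring[OF card_bounded_monomials(1) assms(1), of n m
        "\<lambda>a u. Poly_Mapping.lookup (f u) a" UNIV] by auto
  have "(\<Sum>u\<in>U. Poly_Mapping.single 0 (v u) * f u) = 0"
  proof (rule poly_mapping_eqI)
    fix a
    have "(\<Sum>u\<in>U. Poly_Mapping.lookup (f u) a * v u) = 0"
    proof (cases "a \<in> bounded_monomials n m")
      case False
      have "a \<notin> Poly_Mapping.keys (f u)" if "u \<in> U" for u
        using False assms(3,4)[OF that] by (auto simp: bounded_monomials_def mvars_def exponents_le_def)
      then show ?thesis by (intro sum.neutral) (simp add: in_keys_iff)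
    qed (rule v(2))
    then show "Poly_Mapping.lookup (\<Sum>u\<in>U. Poly_Mapping.single 0 (v u) * f u) a = Poly_Mapping.lookup 0 a"
      by (simp only: lookup_sum lookup_const_mult) (simp add: mult.commute)
  qed
  with v(1) show ?thesis by blast
qed

text \<open>
  The monomial with exponents \<open>b\<close> in the variables \<open>J\<close>, made homogeneous of degree \<open>card J * D\<close> by the
  further variable \<open>j0\<close>. That degree is the largest possible one for exponents at most \<open>D\<close>, so the
  subtraction does not truncate for these.
\<close>

definition homogeneous_monomial :: "('j \<Rightarrow> 'a::comm_ring_1) \<Rightarrow> 'j set \<Rightarrow> 'j \<Rightarrow> nat \<Rightarrow> ('j \<Rightarrow> nat) \<Rightarrow> 'a" where
  "homogeneous_monomial y J j0 D b =
     y j0 ^ (card J * D - (\<Sum>j\<in>J. b j)) * (\<Prod>j\<in>J. y j ^ b j)"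

lemma aeval_homogeneous_monomial:
  "aeval x (homogeneous_monomial e J j0 D b) = homogeneous_monomial (\<lambda>j. aeval x (e j)) J j0 D b"
  by (simp add: homogeneous_monomial_def aeval_simps)

lemma sum_exponents_le:
  assumes "b \<in> J \<rightarrow>\<^sub>E {..D}"
  shows "(\<Sum>j\<in>J. b j) \<le> card J * D"
  using sum_bounded_above[of J b D] assms by auto

lemma homogeneous_monomial_scale:
  fixes y :: "'j \<Rightarrow> 'a::comm_ring_1"
  assumes "b \<in> J \<rightarrow>\<^sub>E {..D}"
  shows "homogeneous_monomial (\<lambda>j. c * y j) J j0 D b = c ^ (card J * D) * homogeneous_monomial y J j0 D b"
proof -
  have "c ^ (card J * D) = c ^ (card J * D - (\<Sum>j\<in>J. b j)) * (\<Prod>j\<in>J. c ^ b j)"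
    using sum_exponents_le[OF assms] by (simp add: power_add[symmetric] power_sum[symmetric])
  then show ?thesis
    by (simp add: homogeneous_monomial_def power_mult_distrib prod.distrib mult_ac)
qed

lemma homogeneous_monomial_cong:
  "(\<And>j. j \<in> insert j0 J \<Longrightarrow> y j = z j) \<Longrightarrow> homogeneous_monomial y J j0 D b = homogeneous_monomial z J j0 D b"
  by (simp add: homogeneous_monomial_def)

text \<open>
  No nontrivial homogeneous polynomial relation holds between \<open>e j0\<close> and the \<open>e j\<close> with \<open>j \<in> J\<close>.
  Equivalently, the quotients \<open>e j / e j0\<close> are algebraically independent.
\<close>

definition homogeneously_independent :: "('j \<Rightarrow> mpoly) \<Rightarrow> 'j set \<Rightarrow> 'j \<Rightarrow> bool" where
  "homogeneously_independent e J j0 \<longleftrightarrow> (\<forall>D (\<alpha> :: ('j \<Rightarrow> nat) \<Rightarrow> real).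
     (\<Sum>b\<in>J \<rightarrow>\<^sub>E {..D}. Poly_Mapping.single 0 (\<alpha> b) * homogeneous_monomial e J j0 D b) = 0 \<longrightarrow>
     (\<forall>b\<in>J \<rightarrow>\<^sub>E {..D}. \<alpha> b = 0))"

text \<open>
  The coefficient of the \<open>k\<close>-th power of the parameter in a polynomial relation between that
  parameter and the functions \<open>e\<close>.
\<close>

definition relation_coeff where
  "relation_coeff e J j0 D v k =
     (\<Sum>b\<in>J \<rightarrow>\<^sub>E {..D}. Poly_Mapping.single 0 (v (k, b)) * homogeneous_monomial e J j0 D b)"

text \<open>
  Each variable is algebraic over \<open>n\<close> independent quotients. The products of \<open>mvar i ^ k\<close> with \<open>k \<le> K\<close>
  and a homogeneous monomial are \<open>(K + 1) * (D + 1) ^ n\<close> in number. If \<open>d\<close> bounds the exponents in the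
  \<open>e j\<close>, they all lie in the space of polynomials with exponents at most \<open>K + n * d * D = 2 * K\<close>, whose
  dimension \<open>(2 * K + 1) ^ n\<close> is smaller for large \<open>D\<close>. By independence some coefficient of the
  resulting linear relation is a nonzero polynomial.
\<close>

lemma algebraic_relation:
  assumes J: "finite J" "card J = n" and i: "i < n"
    and vars: "\<And>j. j \<in> insert j0 J \<Longrightarrow> mvars (e j) \<subseteq> {..<n}"
    and indep: "homogeneously_independent e J j0"
  shows "\<exists>D K v k. (\<Sum>k\<le>K. mvar i ^ k * relation_coeff e J j0 D v k) = 0 \<and>
    k \<le> K \<and> relation_coeff e J j0 D v k \<noteq> 0"
proof -
  define d0 where "d0 j = (SOME m. exponents_le m (e j))" for j
  have d0: "exponents_le (d0 j) (e j)" for j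
    unfolding d0_def using exponents_le_exists by (rule someI_ex)
  define d where "d = Suc (\<Sum>j\<in>insert j0 J. d0 j)"
  have d: "exponents_le d (e j)" if "j \<in> insert j0 J" for j
  proof (rule exponents_le_mono[OF d0])
    show "d0 j \<le> d" using member_le_sum[OF that, of d0] J(1) by (simp add: d_def)
  qed
  \<comment> \<open>Large enough for \<open>(2 * K + 1) ^ n \<le> (2 * n * d + 1) ^ n * (D + 1) ^ n < (K + 1) * (D + 1) ^ n\<close>.\<close>
  define D where "D = (2 * n * d + 1) ^ n"
  define K where "K = n * d * D"
  define U where "U = {..K} \<times> (J \<rightarrow>\<^sub>E {..D})"
  define f where "f = (\<lambda>(k, b). mvar i ^ k * homogeneous_monomial e J j0 D b)"
  have fin: "finite (J \<rightarrow>\<^sub>E {..D})" using J by (simp add: finite_PiE)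
  then have "finite U" by (simp add: U_def)
  moreover have "(2 * K + 1) ^ n < card U"
  proof -
    have "2 * K + 1 \<le> (2 * n * d + 1) * (D + 1)" by (simp add: K_def algebra_simps)
    then have "(2 * K + 1) ^ n \<le> D * (D + 1) ^ n"
      unfolding D_def by (metis power_mono power_mult_distrib zero_le)
    also have "D \<le> K" using i by (simp add: K_def d_def)
    then have "D * (D + 1) ^ n < (K + 1) * (D + 1) ^ n" by (intro mult_strict_right_mono) auto
    also have "\<dots> = card U" using J fin by (simp add: U_def card_cartesian_product card_PiE)
    finally show ?thesis .
  qed
  moreover have "mvars (f u) \<subseteq> {..<n}" if "u \<in> U" for u
  proof -
    obtain k b where u: "u = (k, b)" by fastforce
    have "mvars (mvar i ^ k) \<subseteq> {..<n}" using mvars_power[of "mvar i" k] i by auto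
    moreover have "mvars (e j0 ^ m) \<subseteq> {..<n}" for m using mvars_power[of "e j0" m] vars[of j0] by auto
    moreover have "mvars (\<Prod>j\<in>J. e j ^ b j) \<subseteq> {..<n}"
      by (rule mvars_prod) (use mvars_power vars in blast)
    ultimately show ?thesis
      unfolding u f_def homogeneous_monomial_def prod.case using mvars_mult by (meson Un_least order_trans)
  qed
  moreover have "exponents_le (2 * K) (f u)" if "u \<in> U" for u
  proof -
    obtain k b where u: "u = (k, b)" by fastforce
    have kb: "k \<le> K" "b \<in> J \<rightarrow>\<^sub>E {..D}" using that by (auto simp: u U_def)
    let ?s = "\<Sum>j\<in>J. b j"
    have "exponents_le (1 * k + (d * (card J * D - ?s) + (\<Sum>j\<in>J. d * b j))) (f u)"
      unfolding u f_def homogeneous_monomial_def prod.case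
      by (intro exponents_le_mult exponents_le_power exponents_le_mvar exponents_le_prod J d) auto
    moreover have "d * (card J * D - ?s) + (\<Sum>j\<in>J. d * b j) = K"
      using sum_exponents_le[OF kb(2)] J(2)
      by (simp add: K_def sum_distrib_left[symmetric] distrib_left[symmetric])
    ultimately show ?thesis using kb(1) by (auto elim: exponents_le_mono)
  qed
  ultimately obtain v where v: "\<exists>u\<in>U. v u \<noteq> 0"
    "(\<Sum>u\<in>U. Poly_Mapping.single 0 (v u) * f u) = 0"
    using linear_relation[of U "2 * K" n f] by blast
  let ?H = "relation_coeff e J j0 D v"
  have "(\<Sum>k\<le>K. mvar i ^ k * ?H k) =
      (\<Sum>k\<le>K. \<Sum>b\<in>J \<rightarrow>\<^sub>E {..D}. Poly_Mapping.single 0 (v (k, b)) * f (k, b))"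
    by (simp add: relation_coeff_def f_def sum_distrib_left mult_ac)
  also have "\<dots> = (\<Sum>u\<in>U. Poly_Mapping.single 0 (v u) * f u)"
    unfolding U_def by (simp add: sum.cartesian_product case_prod_unfold)
  finally have rel: "(\<Sum>k\<le>K. mvar i ^ k * ?H k) = 0" using v(2) by simp
  obtain k b where kb: "k \<le> K" "b \<in> J \<rightarrow>\<^sub>E {..D}" "v (k, b) \<noteq> 0"
    using v(1) by (auto simp: U_def)
  have "?H k \<noteq> 0"
  proof
    assume "?H k = 0"
    with indep have "\<forall>b\<in>J \<rightarrow>\<^sub>E {..D}. v (k, b) = 0"
      unfolding homogeneously_independent_def relation_coeff_def
      by (elim allE[of _ D] allE[of _ "\<lambda>b. v (k, b)"]) simp
    with kb show False by blast
  qed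
  with rel kb(1) show ?thesis by blast
qed

text \<open>
  Along a fibre the values of the \<open>e j\<close> keep their proportions, so the homogeneous coefficients of the algebraic relation for
  the variable \<open>i\<close> keep their values up to a common factor. Outside the zero set of one nonzero
  coefficient for each \<open>i\<close>, every coordinate is therefore a root of a fixed nonzero polynomial.
\<close>

lemma generically_finite_to_one_if_independent:
  assumes J: "finite J" "card J = n"
    and vars: "\<And>j. j \<in> insert j0 J \<Longrightarrow> mvars (e j) \<subseteq> {..<n}"
    and pos: "\<And>p. p \<in> pos_space n \<Longrightarrow> meval (e j0) p \<noteq> 0"
    and indep: "homogeneously_independent e J j0"
  shows "generically_finite_to_one n (\<lambda>p. \<lambda>j\<in>J. meval (e j) p / meval (e j0) p)"
proof -
  let ?mon = "homogeneous_monomial e J j0"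
  let ?P = "\<lambda>i D K v k. (\<Sum>k\<le>K. mvar i ^ k * relation_coeff e J j0 D v k) = 0 \<and>
    k \<le> K \<and> relation_coeff e J j0 D v k \<noteq> 0"
  have "\<forall>i. \<exists>D K v k. i < n \<longrightarrow> ?P i D K v k"
    using algebraic_relation[OF J _ vars indep] by blast
  then obtain D K v k where P: "\<And>i. i < n \<Longrightarrow> ?P i (D i) (K i) (v i) (k i)"
    unfolding choice_iff by blast
  define H where "H i = relation_coeff e J j0 (D i) (v i)" for i
  have rel: "(\<Sum>k\<le>K i. mvar i ^ k * H i k) = 0" and k: "k i \<le> K i" "H i (k i) \<noteq> 0" if "i < n" for i
    using P[OF that] by (simp_all add: H_def)
  \<comment> \<open>The exceptional algebraic set is the zero set of \<open>g\<close>.\<close>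
  define g where "g = (\<Prod>i<n. H i (k i))"
  have "g \<noteq> 0" using k by (auto simp: g_def)
  have "mvars (H i l) \<subseteq> {..<n}" if "i < n" for i l
  proof -
    have "mvars (?mon (D i) b) \<subseteq> {..<n}" for b
    proof -
      have "mvars (e j0 ^ m) \<subseteq> {..<n}" for m using mvars_power[of "e j0" m] vars[of j0] by auto
      moreover have "mvars (\<Prod>j\<in>J. e j ^ b j) \<subseteq> {..<n}"
        by (rule mvars_prod) (use mvars_power vars in blast)
      ultimately show ?thesis
        unfolding homogeneous_monomial_def using mvars_mult by (meson Un_least order_trans)
    qed
    then show ?thesis unfolding H_def relation_coeff_def
      by (intro mvars_sum order_trans[OF mvars_mult]) simp
  qed
  then have g_vars: "mvars g \<subseteq> {..<n}" unfolding g_def by (intro mvars_prod) auto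
  define A where "A = {x \<in> real_space n. meval g x = 0}"
  have "algebraic_subset n A"
    unfolding algebraic_subset_def A_def using g_vars by (intro exI[of _ "{g}"]) auto
  moreover have "A \<noteq> real_space n"
  proof -
    obtain p where "p \<in> pos_space n" "meval g p \<noteq> 0"
      using nonzero_mpoly_nonzero_at_positive_point[OF \<open>g \<noteq> 0\<close> g_vars] by blast
    moreover from this have "p \<in> real_space n" by (auto simp: pos_space_def real_space_def)
    ultimately show ?thesis by (auto simp: A_def)
  qed
  moreover have "finite {q \<in> pos_space n. (\<lambda>j\<in>J. meval (e j) q / meval (e j0) q) = (\<lambda>j\<in>J. meval (e j) p / meval (e j0) p)}"
    (is "finite ?F") if p: "p \<in> pos_space n - A" for p
  proof -
    have p': "p \<in> pos_space n" "p \<in> real_space n" using p by (auto simp: pos_space_def real_space_def)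
    then have "meval g p \<noteq> 0" using p by (auto simp: A_def)
    then have Hp: "meval (H i (k i)) p \<noteq> 0" if "i < n" for i
      using that by (auto simp: g_def meval_eq_aeval aeval_prod)
    define R where "R i = (\<Sum>l\<le>K i. monom (meval (H i l) p) l)" for i
    have "R i \<noteq> 0" if "i < n" for i
    proof
      assume "R i = 0"
      then have "0 = coeff (R i) (k i)" by simp
      also have "\<dots> = meval (H i (k i)) p" using k(1)[OF that] by (simp add: R_def coeff_sum)
      finally show False using Hp[OF that] by simp
    qed
    have "q i \<in> {r. poly (R i) r = 0}" if q: "q \<in> ?F" and i: "i < n" for q i
    proof -
      define c where "c = meval (e j0) q / meval (e j0) p"
      have e0: "meval (e j0) p \<noteq> 0" "meval (e j0) q \<noteq> 0" using pos p' q by auto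
      have proportional: "meval (e j) q = c * meval (e j) p" if "j \<in> insert j0 J" for j
      proof (cases "j = j0")
        case True
        then show ?thesis using e0 by (simp add: c_def)
      next
        case False
        then have "j \<in> J" using that by simp
        from q have "(\<lambda>j\<in>J. meval (e j) q / meval (e j0) q) = (\<lambda>j\<in>J. meval (e j) p / meval (e j0) p)"
          by simp
        from fun_cong[OF this, of j] \<open>j \<in> J\<close>
        have "meval (e j) q / meval (e j0) q = meval (e j) p / meval (e j0) p" by simp
        then show ?thesis using e0 by (simp add: c_def field_simps)
      qed
      have "meval (?mon (D i) b) q = c ^ (card J * D i) * meval (?mon (D i) b) p"
        if "b \<in> J \<rightarrow>\<^sub>E {..D i}" for b
        unfolding meval_eq_aeval aeval_homogeneous_monomial homogeneous_monomial_scale[OF that, symmetric]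
        by (rule homogeneous_monomial_cong) (use proportional in \<open>simp add: meval_eq_aeval\<close>)
      then have Hq: "meval (H i l) q = c ^ (card J * D i) * meval (H i l) p" for l
        unfolding H_def relation_coeff_def by (simp add: meval_eq_aeval aeval_simps sum_distrib_left mult_ac)
      have "0 = meval (\<Sum>l\<le>K i. mvar i ^ l * H i l) q" using rel[OF i] by (simp add: meval_eq_aeval)
      also have "\<dots> = (\<Sum>l\<le>K i. q i ^ l * meval (H i l) q)" by (simp add: meval_eq_aeval aeval_simps)
      also have "\<dots> = c ^ (card J * D i) * poly (R i) (q i)"
        by (simp add: Hq R_def poly_sum poly_monom sum_distrib_left mult_ac)
      finally show ?thesis using e0 by (simp add: c_def)
    qed
    then have "?F \<subseteq> (\<Pi>\<^sub>E i\<in>{..<n}. {r. poly (R i) r = 0})"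
      by (auto simp: pos_space_def PiE_def)
    moreover have "finite (\<Pi>\<^sub>E i\<in>{..<n}. {r. poly (R i) r = 0})"
      using \<open>\<And>i. i < n \<Longrightarrow> R i \<noteq> 0\<close> by (intro finite_PiE) (auto intro: poly_roots_finite)
    ultimately show ?thesis by (rule finite_subset)
  qed
  ultimately show ?thesis unfolding generically_finite_to_one_def by blast
qed

section \<open>Differential calculus of real polynomials\<close>

lemma prod_single_one:
  "(\<Prod>i\<in>I. Poly_Mapping.single (f i) 1 :: mpoly) = Poly_Mapping.single (sum f I) 1"
  by (induction I rule: infinite_finite_induct) (auto simp: mult_single)

lemma mvar_power: "mvar i ^ k = Poly_Mapping.single (Poly_Mapping.single i k) 1"
proof (induction k)
  case (Suc k)
  then show ?case by (simp add: mvar_def mult_single single_add[symmetric])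
qed simp

text \<open>
  Polynomials in the variables \<open>V\<close> are generated from constants and variables by sums and products.
\<close>

lemma mpoly_induct [consumes 1, case_names const mvar add mult]:
  assumes "mvars g \<subseteq> V"
    and const: "\<And>c. P (Poly_Mapping.single 0 c)" and mvar: "\<And>i. i \<in> V \<Longrightarrow> P (mvar i)"
    and add: "\<And>g h. P g \<Longrightarrow> P h \<Longrightarrow> P (g + h)" and mult: "\<And>g h. P g \<Longrightarrow> P h \<Longrightarrow> P (g * h)"
  shows "P g"
proof -
  have one: "P 1" using const[of 1] by simp
  have power: "P (g ^ k)" if "P g" for g k by (induction k) (auto intro: one mult that)
  have prod: "P (prod f I)" if "\<And>i. i \<in> I \<Longrightarrow> P (f i)" for f and I :: "nat set"
    using that by (induction I rule: infinite_finite_induct) (auto intro: one mult)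
  have sum: "P (sum f K)" if "\<And>a. a \<in> K \<Longrightarrow> P (f a)" for f and K :: "(nat \<Rightarrow>\<^sub>0 nat) set"
    using that const[of 0] by (induction K rule: infinite_finite_induct) (auto intro: add)
  have "P (Poly_Mapping.single a c)" if "a \<in> Poly_Mapping.keys g" for a c
  proof -
    have "Poly_Mapping.keys a \<subseteq> V" using assms(1) that by (auto simp: mvars_def)
    then have "P (Poly_Mapping.single 0 c * (\<Prod>i\<in>Poly_Mapping.keys a. mvar i ^ Poly_Mapping.lookup a i))"
      by (intro mult const prod power mvar) auto
    also have "(\<Prod>i\<in>Poly_Mapping.keys a. mvar i ^ Poly_Mapping.lookup a i) = Poly_Mapping.single a 1"
      by (simp add: mvar_power prod_single_one sum_singles)
    finally show ?thesis by (simp add: mult_single)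
  qed
  then have "P (\<Sum>a\<in>Poly_Mapping.keys g. Poly_Mapping.single a (Poly_Mapping.lookup g a))"
    by (intro sum)
  then show ?thesis by (simp add: sum_singles)
qed

text \<open>
  The polynomials \<open>d i\<close> serve as partial derivatives of \<open>g\<close>. They are specified by the chain rule along
  curves, the form in which a flow meets them.
\<close>

definition is_gradient :: "nat \<Rightarrow> mpoly \<Rightarrow> (nat \<Rightarrow> mpoly) \<Rightarrow> bool" where
  "is_gradient n g d \<longleftrightarrow> (\<forall>i. mvars (d i) \<subseteq> {..<n}) \<and>
    (\<forall>x x' t S. (\<forall>i<n. ((\<lambda>s. x s i) has_real_derivative x' i) (at t within S)) \<longrightarrow>
      ((\<lambda>s. meval g (x s)) has_real_derivative (\<Sum>i<n. meval (d i) (x t) * x' i)) (at t within S))"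

lemma is_gradientD:
  assumes "is_gradient n g d" "\<And>i. i < n \<Longrightarrow> ((\<lambda>s. x s i) has_real_derivative x' i) (at t within S)"
  shows "((\<lambda>s. meval g (x s)) has_real_derivative (\<Sum>i<n. meval (d i) (x t) * x' i)) (at t within S)"
  using assms unfolding is_gradient_def by blast

lemma is_gradient_mvars: "is_gradient n g d \<Longrightarrow> mvars (d i) \<subseteq> {..<n}"
  unfolding is_gradient_def by blast

lemma is_gradient_const: "is_gradient n (Poly_Mapping.single 0 c) (\<lambda>_. 0)"
  by (simp add: is_gradient_def meval_eq_aeval aeval_const)

lemma is_gradient_mvar:
  assumes "j < n"
  shows "is_gradient n (mvar j) (\<lambda>i. if i = j then 1 else 0)"
proof -
  have "(\<Sum>i<n. meval (if i = j then 1 else 0) x * x' i) = x' j" for x x'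
  proof -
    have "(\<Sum>i<n. meval (if i = j then 1 else 0) x * x' i) = (\<Sum>i<n. if i = j then x' i else 0)"
      by (intro sum.cong) (auto simp: meval_eq_aeval)
    then show ?thesis using assms by simp
  qed
  then show ?thesis using assms by (simp add: is_gradient_def) (simp add: meval_eq_aeval)
qed

lemma is_gradient_add:
  assumes g: "is_gradient n g d" and h: "is_gradient n h d'"
  shows "is_gradient n (g + h) (\<lambda>i. d i + d' i)"
  unfolding is_gradient_def
proof (intro conjI allI impI)
  show "mvars (d i + d' i) \<subseteq> {..<n}" for i
    using mvars_add[of "d i" "d' i"] is_gradient_mvars[OF g, of i] is_gradient_mvars[OF h, of i] by blast
  fix x x' t S
  assume *: "\<forall>i<n. ((\<lambda>s. x s i) has_real_derivative x' i) (at t within S)"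
  then show "((\<lambda>s. meval (g + h) (x s)) has_real_derivative (\<Sum>i<n. meval (d i + d' i) (x t) * x' i)) (at t within S)"
    using DERIV_add[OF is_gradientD[OF g] is_gradientD[OF h], of x x' t S x x']
    by (simp add: meval_eq_aeval aeval_simps distrib_right sum.distrib)
qed

lemma is_gradient_mult:
  assumes g: "is_gradient n g d" "mvars g \<subseteq> {..<n}" and h: "is_gradient n h d'" "mvars h \<subseteq> {..<n}"
  shows "is_gradient n (g * h) (\<lambda>i. d i * h + g * d' i)"
  unfolding is_gradient_def
proof (intro conjI allI impI)
  show "mvars (d i * h + g * d' i) \<subseteq> {..<n}" for i
    using mvars_add[of "d i * h" "g * d' i"] mvars_mult[of "d i" h] mvars_mult[of g "d' i"] g(2) h(2)
      is_gradient_mvars[OF g(1), of i] is_gradient_mvars[OF h(1), of i] by blast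
  fix x x' t S
  assume *: "\<forall>i<n. ((\<lambda>s. x s i) has_real_derivative x' i) (at t within S)"
  have "(\<Sum>i<n. meval (d i * h + g * d' i) (x t) * x' i) =
      (\<Sum>i<n. meval (d i) (x t) * x' i) * meval h (x t) + (\<Sum>i<n. meval (d' i) (x t) * x' i) * meval g (x t)"
    by (simp add: meval_eq_aeval aeval_simps algebra_simps sum.distrib sum_distrib_left)
  then show "((\<lambda>s. meval (g * h) (x s)) has_real_derivative
      (\<Sum>i<n. meval (d i * h + g * d' i) (x t) * x' i)) (at t within S)"
    using DERIV_mult[OF is_gradientD[OF g(1)] is_gradientD[OF h(1)], of x x' t S x x'] *
    by (simp add: meval_eq_aeval aeval_simps)
qed

lemma is_gradient_exists:
  assumes "mvars g \<subseteq> {..<n}"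
  shows "\<exists>d. is_gradient n g d"
proof -
  from assms have "mvars g \<subseteq> {..<n} \<and> (\<exists>d. is_gradient n g d)"
  proof (induction g rule: mpoly_induct)
    case (add g h)
    then show ?case using mvars_add[of g h] is_gradient_add by blast
  next
    case (mult g h)
    then show ?case using mvars_mult[of g h] is_gradient_mult by blast
  qed (auto intro: is_gradient_const is_gradient_mvar)
  then show ?thesis by blast
qed

text \<open>
  A bound \<open>M\<close> and a Lipschitz constant \<open>L\<close> for the maximum norm on the box of radius \<open>R\<close>.
\<close>

definition tame_on_box :: "nat \<Rightarrow> real \<Rightarrow> ((nat \<Rightarrow> real) \<Rightarrow> real) \<Rightarrow> real \<Rightarrow> real \<Rightarrow> bool" where
  "tame_on_box n R f M L \<longleftrightarrow> 0 \<le> M \<and> 0 \<le> L \<and> (\<forall>x. (\<forall>i<n. \<bar>x i\<bar> \<le> R) \<longrightarrow> \<bar>f x\<bar> \<le> M) \<and>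
    (\<forall>x y \<delta>. (\<forall>i<n. \<bar>x i\<bar> \<le> R) \<longrightarrow> (\<forall>i<n. \<bar>y i\<bar> \<le> R) \<longrightarrow> 0 \<le> \<delta> \<longrightarrow> (\<forall>i<n. \<bar>x i - y i\<bar> \<le> \<delta>) \<longrightarrow>
      \<bar>f x - f y\<bar> \<le> L * \<delta>)"

lemma tame_on_boxD:
  assumes "tame_on_box n R f M L" "\<And>i. i < n \<Longrightarrow> \<bar>x i\<bar> \<le> R"
  shows "\<bar>f x\<bar> \<le> M"
    and "(\<And>i. i < n \<Longrightarrow> \<bar>y i\<bar> \<le> R) \<Longrightarrow> 0 \<le> \<delta> \<Longrightarrow> (\<And>i. i < n \<Longrightarrow> \<bar>x i - y i\<bar> \<le> \<delta>) \<Longrightarrow>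
      \<bar>f x - f y\<bar> \<le> L * \<delta>"
  using assms unfolding tame_on_box_def by blast+

lemma tame_on_box_nonneg: "tame_on_box n R f M L \<Longrightarrow> 0 \<le> M \<and> 0 \<le> L"
  by (simp add: tame_on_box_def)

lemma tame_on_box_add:
  assumes f: "tame_on_box n R f M L" and g: "tame_on_box n R g M' L'"
  shows "tame_on_box n R (\<lambda>x. f x + g x) (M + M') (L + L')"
  unfolding tame_on_box_def
proof (intro conjI allI impI)
  show "0 \<le> M + M'" "0 \<le> L + L'" using tame_on_box_nonneg[OF f] tame_on_box_nonneg[OF g] by auto
  fix x y :: "nat \<Rightarrow> real" and \<delta> :: real assume x: "\<forall>i<n. \<bar>x i\<bar> \<le> R"
  show "\<bar>f x + g x\<bar> \<le> M + M'"
    using tame_on_boxD(1)[OF f, of x] tame_on_boxD(1)[OF g, of x] x by fastforce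
  assume "\<forall>i<n. \<bar>y i\<bar> \<le> R" "0 \<le> \<delta>" "\<forall>i<n. \<bar>x i - y i\<bar> \<le> \<delta>"
  then have "\<bar>f x - f y\<bar> \<le> L * \<delta>" "\<bar>g x - g y\<bar> \<le> L' * \<delta>"
    using tame_on_boxD(2)[OF f, of x y \<delta>] tame_on_boxD(2)[OF g, of x y \<delta>] x by simp_all
  then show "\<bar>f x + g x - (f y + g y)\<bar> \<le> (L + L') * \<delta>" by (simp add: distrib_right)
qed

lemma tame_on_box_mult:
  assumes f: "tame_on_box n R f M L" and g: "tame_on_box n R g M' L'"
  shows "tame_on_box n R (\<lambda>x. f x * g x) (M * M') (M * L' + L * M')"
  unfolding tame_on_box_def
proof (intro conjI allI impI)
  note nonneg = tame_on_box_nonneg[OF f] tame_on_box_nonneg[OF g]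
  then show "0 \<le> M * M'" "0 \<le> M * L' + L * M'" by auto
  fix x y :: "nat \<Rightarrow> real" and \<delta> :: real assume x: "\<forall>i<n. \<bar>x i\<bar> \<le> R"
  have fx: "\<bar>f x\<bar> \<le> M" and gx: "\<bar>g x\<bar> \<le> M'"
    using tame_on_boxD(1)[OF f, of x] tame_on_boxD(1)[OF g, of x] x by simp_all
  then show "\<bar>f x * g x\<bar> \<le> M * M'" unfolding abs_mult by (intro mult_mono) auto
  assume y: "\<forall>i<n. \<bar>y i\<bar> \<le> R" and \<delta>: "0 \<le> \<delta>" "\<forall>i<n. \<bar>x i - y i\<bar> \<le> \<delta>"
  have gy: "\<bar>g y\<bar> \<le> M'" using tame_on_boxD(1)[OF g, of y] y by simp
  have d: "\<bar>f x - f y\<bar> \<le> L * \<delta>" "\<bar>g x - g y\<bar> \<le> L' * \<delta>"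
    using tame_on_boxD(2)[OF f, of x y \<delta>] tame_on_boxD(2)[OF g, of x y \<delta>] x y \<delta> by simp_all
  have "f x * g x - f y * g y = f x * (g x - g y) + (f x - f y) * g y"
    by (simp add: algebra_simps)
  also have "\<bar>\<dots>\<bar> \<le> \<bar>f x\<bar> * \<bar>g x - g y\<bar> + \<bar>f x - f y\<bar> * \<bar>g y\<bar>"
    by (metis abs_mult abs_triangle_ineq)
  also have "\<dots> \<le> M * (L' * \<delta>) + (L * \<delta>) * M'"
    using nonneg \<delta> by (intro add_mono mult_mono fx gy d) auto
  finally show "\<bar>f x * g x - f y * g y\<bar> \<le> (M * L' + L * M') * \<delta>" by (simp add: algebra_simps)
qed

lemma meval_tame_on_box:
  assumes "mvars g \<subseteq> {..<n}"
  shows "\<exists>M L. tame_on_box n R (meval g) M L"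
  using assms
proof (induction g rule: mpoly_induct)
  case (const c)
  have "tame_on_box n R (meval (Poly_Mapping.single 0 c)) \<bar>c\<bar> 0"
    by (simp add: tame_on_box_def meval_eq_aeval aeval_const)
  then show ?case by blast
next
  case (mvar j)
  then have "tame_on_box n R (meval (mvar j)) \<bar>R\<bar> 1"
    by (force simp: tame_on_box_def meval_eq_aeval)
  then show ?case by blast
next
  case (add g h)
  then obtain M L M' L' where "tame_on_box n R (meval g) M L" "tame_on_box n R (meval h) M' L'" by blast
  from tame_on_box_add[OF this] show ?case by (auto simp: meval_eq_aeval aeval_simps fun_eq_iff)
next
  case (mult g h)
  then obtain M L M' L' where "tame_on_box n R (meval g) M L" "tame_on_box n R (meval h) M' L'" by blast
  from tame_on_box_mult[OF this] show ?case by (auto simp: meval_eq_aeval aeval_simps fun_eq_iff)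
qed

section \<open>Flow of a Lipschitz vector field\<close>

text \<open>
  A finite family of bounded continuous functions of time, packed into one bounded continuous
  function of time and index. The supremum norm of the latter is the maximum of the norms in the
  family, so that the Banach space of bounded continuous functions serves for curves in \<open>\<real>\<^sup>n\<close> with
  variable \<open>n\<close>.
\<close>

lemma finite_family_bcontfun:
  fixes h :: "nat \<Rightarrow> real \<Rightarrow> real"
  assumes cont: "\<And>i. i < n \<Longrightarrow> continuous_on UNIV (h i)" and bound: "\<And>i t. i < n \<Longrightarrow> \<bar>h i t\<bar> \<le> b i"
  shows "(\<lambda>(t, i). if i < n then h i t else 0) \<in> bcontfun"
proof (rule bcontfun_normI)
  let ?H = "\<lambda>(t, i). if i < n then h i t else 0"
  have "continuous_on (UNIV \<times> {i}) ?H" for i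
  proof (cases "i < n")
    case True
    have "continuous_on (UNIV \<times> {i}) (\<lambda>z. h i (fst z))"
      by (intro continuous_on_compose2[OF cont[OF True]] continuous_intros) auto
    then show ?thesis
      by (rule continuous_on_eq) (use True in auto)
  next
    case False
    have "continuous_on (UNIV \<times> {i}) (\<lambda>_. 0 :: real)" by (rule continuous_on_const)
    then show ?thesis by (rule continuous_on_eq) (use False in auto)
  qed
  moreover have "open ((UNIV :: real set) \<times> {i})" for i :: nat
    by (intro open_Times open_UNIV open_discrete)
  ultimately have "continuous_on (\<Union>i\<in>UNIV. UNIV \<times> {i}) ?H"
    by (intro continuous_on_open_UN) auto
  moreover have "(\<Union>i\<in>UNIV. (UNIV :: real set) \<times> {i :: nat}) = UNIV" by auto
  ultimately show "continuous_on UNIV ?H" by simp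
  fix z :: "real \<times> nat"
  obtain t i where z: "z = (t, i)" by fastforce
  show "norm (?H z) \<le> (\<Sum>i<n. \<bar>b i\<bar>)"
  proof (cases "i < n")
    case True
    then have "\<bar>b i\<bar> \<le> (\<Sum>i<n. \<bar>b i\<bar>)" by (intro member_le_sum) auto
    then show ?thesis using bound[OF True, of t] True by (simp add: z)
  qed (simp add: z sum_nonneg)
qed

text \<open>
  The theorem of Picard and Lindeloef for a vector field on \<open>\<real>\<^sup>n\<close> that is bounded by \<open>M\<close> and Lipschitz
  with constant \<open>L\<close> on a box around \<open>p\<close>. The Picard operator is a contraction with constant \<open>1 / 2\<close> on
  the curves that stay in the box.
\<close>

lemma local_flow:
  fixes f :: "nat \<Rightarrow> (nat \<Rightarrow> real) \<Rightarrow> real"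
  assumes "\<rho> > 0" "0 \<le> M" "0 \<le> L"
    and bound: "\<And>i x. i < n \<Longrightarrow> (\<And>j. j < n \<Longrightarrow> \<bar>x j - p j\<bar> \<le> \<rho>) \<Longrightarrow> \<bar>f i x\<bar> \<le> M"
    and lip: "\<And>i x y \<delta>. i < n \<Longrightarrow> (\<And>j. j < n \<Longrightarrow> \<bar>x j - p j\<bar> \<le> \<rho>) \<Longrightarrow> (\<And>j. j < n \<Longrightarrow> \<bar>y j - p j\<bar> \<le> \<rho>) \<Longrightarrow>
        0 \<le> \<delta> \<Longrightarrow> (\<And>j. j < n \<Longrightarrow> \<bar>x j - y j\<bar> \<le> \<delta>) \<Longrightarrow> \<bar>f i x - f i y\<bar> \<le> L * \<delta>"
  shows "\<exists>\<tau>>0. \<exists>x. \<forall>i<n. x 0 i = p i \<and> (\<forall>t\<in>{0..\<tau>}. \<bar>x t i - p i\<bar> \<le> \<rho> \<and>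
           ((\<lambda>s. x s i) has_real_derivative f i (x t)) (at t within {0..\<tau>}))"
proof -
  define \<tau> where "\<tau> = min (\<rho> / (M + 1)) (1 / (2 * (L + 1)))"
  have "\<tau> > 0" using assms(1-3) by (simp add: \<tau>_def)
  have \<tau>M: "M * \<tau> \<le> \<rho>"
  proof -
    have "M * \<tau> \<le> M * (\<rho> / (M + 1))" using assms(2) by (intro mult_left_mono) (auto simp: \<tau>_def)
    also have "\<dots> \<le> \<rho>" using assms(1,2) by (simp add: field_simps)
    finally show ?thesis .
  qed
  have \<tau>L: "L * \<tau> \<le> 1 / 2"
  proof -
    have "L * \<tau> \<le> L * (1 / (2 * (L + 1)))" using assms(3) by (intro mult_left_mono) (auto simp: \<tau>_def)
    also have "\<dots> \<le> 1 / 2" using assms(3) by (simp add: field_simps)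
    finally show ?thesis .
  qed
  \<comment> \<open>Curves are extended to all times by stopping them outside the interval from \<open>0\<close> to \<open>\<tau>\<close>.\<close>
  define clip where "clip t = max 0 (min \<tau> t)" for t
  have clip: "0 \<le> clip t" "clip t \<le> \<tau>" for t
    using \<open>\<tau> > 0\<close> by (auto simp: clip_def)
  have clip_cont: "continuous_on UNIV clip"
    unfolding clip_def by (intro continuous_intros)
  define at_time :: "((real \<times> nat) \<Rightarrow>\<^sub>C real) \<Rightarrow> real \<Rightarrow> nat \<Rightarrow> real"
    where "at_time x s j = apply_bcontfun x (s, j)" for x s j
  define X where "X = {x. \<forall>t i. if i < n then \<bar>at_time x t i - p i\<bar> \<le> \<rho> else at_time x t i = 0}"
  have X_iff: "x \<in> X \<longleftrightarrow> (\<forall>t i. if i < n then \<bar>at_time x t i - p i\<bar> \<le> \<rho> else at_time x t i = 0)" for x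
    by (simp add: X_def)
  then have near: "\<bar>at_time x t i - p i\<bar> \<le> \<rho>" if "x \<in> X" "i < n" for x t i
    using that by metis
  have at_time_cont: "continuous_on T (\<lambda>s. at_time x s j)" for x T j
    unfolding at_time_def
    by (intro continuous_on_compose2[OF continuous_on_apply_bcontfun[of UNIV]] continuous_intros) auto
  have field_cont: "continuous_on T (\<lambda>s. f i (at_time x s))" if x: "x \<in> X" and i: "i < n" for x i T
    unfolding continuous_on_def
  proof
    fix s0 assume "s0 \<in> T"
    let ?d = "\<lambda>s. \<Sum>j<n. \<bar>at_time x s j - at_time x s0 j\<bar>"
    have "((\<lambda>s. L * ?d s) \<longlongrightarrow> L * (\<Sum>j<n. \<bar>at_time x s0 j - at_time x s0 j\<bar>)) (at s0 within T)"
      using at_time_cont[of T x] \<open>s0 \<in> T\<close> unfolding continuous_on_def by (intro tendsto_intros) auto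
    then have lim: "((\<lambda>s. L * ?d s) \<longlongrightarrow> 0) (at s0 within T)" by simp
    have le: "\<bar>f i (at_time x s) - f i (at_time x s0)\<bar> \<le> L * ?d s" for s
    proof (rule lip)
      show "i < n" by (rule i)
      show "\<bar>at_time x s j - p j\<bar> \<le> \<rho>" "\<bar>at_time x s0 j - p j\<bar> \<le> \<rho>" if "j < n" for j
        by (rule near[OF x that])+
      show "0 \<le> ?d s" by (intro sum_nonneg) simp
      show "\<bar>at_time x s j - at_time x s0 j\<bar> \<le> ?d s" if "j < n" for j
        using that by (intro member_le_sum[of j "{..<n}" "\<lambda>j. \<bar>at_time x s j - at_time x s0 j\<bar>"]) auto
    qed
    have "\<forall>\<^sub>F s in at s0 within T. norm (f i (at_time x s) - f i (at_time x s0)) \<le> L * ?d s"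
      unfolding real_norm_def using le by (rule always_eventually[OF allI])
    from Lim_null_comparison[OF this lim]
    have "((\<lambda>s. f i (at_time x s) - f i (at_time x s0)) \<longlongrightarrow> 0) (at s0 within T)" .
    then show "((\<lambda>s. f i (at_time x s)) \<longlongrightarrow> f i (at_time x s0)) (at s0 within T)"
      by (rule LIM_zero_cancel)
  qed
  define I where "I x i t = integral {0..clip t} (\<lambda>s. f i (at_time x s))" for x i t
  have I_bound: "\<bar>I x i t\<bar> \<le> \<rho>" if "x \<in> X" "i < n" for x i t
  proof -
    have "\<bar>I x i t\<bar> \<le> M * (clip t - 0)"
      unfolding I_def real_norm_def[symmetric]
    proof (rule integral_bound[OF clip(1) field_cont[OF that]])
      show "norm (f i (at_time x s)) \<le> M" for s
        unfolding real_norm_def by (intro bound near that)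
    qed
    also have "\<dots> \<le> M * \<tau>" using clip assms(2) by (simp add: mult_left_mono)
    finally show ?thesis using \<tau>M by simp
  qed
  have I_cont: "continuous_on UNIV (I x i)" if "x \<in> X" "i < n" for x i
  proof -
    have "continuous_on {0..\<tau>} (\<lambda>u. integral {0..u} (\<lambda>s. f i (at_time x s)))"
      by (intro indefinite_integral_continuous_1 integrable_continuous_real field_cont that)
    then show ?thesis
      unfolding I_def using clip_cont by (rule continuous_on_compose2) (use clip in auto)
  qed
  define picard where "picard x = Bcontfun (\<lambda>(t, i). if i < n then p i + I x i t else 0)" for x
  have picard: "at_time (picard x) t i = (if i < n then p i + I x i t else 0)" if "x \<in> X" for x t i
  proof -
    have "(\<lambda>(t, i). if i < n then p i + I x i t else 0) \<in> bcontfun"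
    proof (rule finite_family_bcontfun)
      show "continuous_on UNIV (\<lambda>t. p i + I x i t)" if "i < n" for i
        by (intro continuous_intros I_cont \<open>x \<in> X\<close> that)
      show "\<bar>p i + I x i t\<bar> \<le> \<bar>p i\<bar> + \<rho>" if "i < n" for i t
        using I_bound[OF \<open>x \<in> X\<close> that, of t] by linarith
    qed
    then show ?thesis by (simp add: at_time_def picard_def Bcontfun_inverse)
  qed
  have "\<exists>!x\<in>X. picard x = x"
  proof (rule Banach_fix[where c = "1 / 2"])
    show "complete X"
      unfolding complete_def
    proof (intro allI impI, elim conjE)
      fix u assume u: "\<forall>k. u k \<in> X" and "Cauchy u"
      then obtain g where "uniform_limit UNIV (\<lambda>k. apply_bcontfun (u k)) g sequentially"
        using uniformly_convergent_eq_cauchy[of "\<lambda>_. True" "\<lambda>k. apply_bcontfun (u k)"]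
        unfolding Cauchy_def uniform_limit_sequentially_iff
        by (metis dist_fun_lt_imp_dist_val_lt)
      then obtain l where l: "u \<longlonglongrightarrow> l"
        using uniform_limit_bcontfunE[OF _ sequentially_bot] by metis
      have lim: "(\<lambda>k. at_time (u k) t i) \<longlonglongrightarrow> at_time l t i" for t i
        unfolding at_time_def
        by (rule tendsto_uniform_limitI[OF tendsto_bcontfun_uniform_limit[OF l]]) simp
      have "at_time (u k) t i \<in> (if i < n then {p i - \<rho>..p i + \<rho>} else {0})" for k t i
        using u[rule_format, of k, unfolded X_iff, rule_format, of i t]
        by (auto simp: abs_le_iff split: if_splits)
      from closed_sequentially[OF _ this lim]
      have mem: "at_time l t i \<in> (if i < n then {p i - \<rho>..p i + \<rho>} else {0})" for t i by simp
      have "if i < n then \<bar>at_time l t i - p i\<bar> \<le> \<rho> else at_time l t i = 0" for t i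
        using mem[of t i] by (auto simp: abs_le_iff split: if_splits)
      then have "l \<in> X" unfolding X_iff by blast
      with l show "\<exists>l\<in>X. u \<longlonglongrightarrow> l" by blast
    qed
    have "(\<lambda>(t :: real, i). if i < n then p i else 0) \<in> bcontfun"
      by (rule finite_family_bcontfun[of n "\<lambda>i t. p i" "\<lambda>i. \<bar>p i\<bar>"]) auto
    then have "Bcontfun (\<lambda>(t :: real, i). if i < n then p i else 0) \<in> X"
      unfolding X_iff using assms(1) by (simp add: at_time_def Bcontfun_inverse)
    then show "X \<noteq> {}" by blast
    show "picard ` X \<subseteq> X" using I_bound by (auto simp: X_iff[of "picard _"] picard)
    fix x y assume xy: "x \<in> X" "y \<in> X"
    show "dist (picard x) (picard y) \<le> 1 / 2 * dist x y"
    proof (rule dist_bound)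
      fix z :: "real \<times> nat"
      obtain t i where z: "z = (t, i)" by fastforce
      have "\<bar>at_time (picard x) t i - at_time (picard y) t i\<bar> \<le> 1 / 2 * dist x y"
      proof (cases "i < n")
        case i: True
        have "\<bar>I x i t - I y i t\<bar> = \<bar>integral {0..clip t} (\<lambda>s. f i (at_time x s) - f i (at_time y s))\<bar>"
          unfolding I_def
          by (subst integral_diff) (intro integrable_continuous_real field_cont xy i refl)+
        also have "\<dots> \<le> L * dist x y * (clip t - 0)"
          unfolding real_norm_def[symmetric]
        proof (rule integral_bound[OF clip(1)])
          show "continuous_on {0..clip t} (\<lambda>s. f i (at_time x s) - f i (at_time y s))"
            by (intro continuous_intros field_cont xy i)
          have "\<bar>f i (at_time x s) - f i (at_time y s)\<bar> \<le> L * dist x y" for s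
          proof (rule lip)
            show "i < n" by (rule i)
            show "\<bar>at_time x s j - p j\<bar> \<le> \<rho>" "\<bar>at_time y s j - p j\<bar> \<le> \<rho>" if "j < n" for j
              using near xy that by blast+
            show "\<bar>at_time x s j - at_time y s j\<bar> \<le> dist x y" for j
              using dist_bounded[of x "(s, j)" y] by (simp add: at_time_def dist_real_def)
          qed simp
          then show "norm (f i (at_time x s) - f i (at_time y s)) \<le> L * dist x y" for s
            by (simp only: real_norm_def)
        qed
        also have "\<dots> \<le> L * dist x y * \<tau>" using clip assms(3) by (intro mult_left_mono) auto
        also have "\<dots> = (L * \<tau>) * dist x y" by simp
        also have "\<dots> \<le> 1 / 2 * dist x y" using \<tau>L by (intro mult_right_mono) auto
        finally show ?thesis using xy i by (simp add: picard)
      qed (use xy in \<open>simp add: picard\<close>)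
      then show "dist (apply_bcontfun (picard x) z) (apply_bcontfun (picard y) z) \<le> 1 / 2 * dist x y"
        by (simp add: z at_time_def dist_real_def)
    qed
  qed auto
  then obtain x where x: "x \<in> X" "picard x = x" by blast
  have flow: "at_time x t i = p i + I x i t" if "i < n" for t i
    using picard[OF x(1), of t i] that by (simp add: x(2))
  have "((\<lambda>s. at_time x s i) has_real_derivative f i (at_time x t)) (at t within {0..\<tau>})"
    if i: "i < n" and t: "t \<in> {0..\<tau>}" for i t
  proof (rule has_field_derivative_transform_within[OF _ zero_less_one t])
    have "((\<lambda>u. integral {0..u} (\<lambda>s. f i (at_time x s))) has_real_derivative f i (at_time x t)) (at t within {0..\<tau>})"
      unfolding has_real_derivative_iff_has_vector_derivative
      by (intro integral_has_vector_derivative field_cont x i t)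
    from DERIV_add[OF DERIV_const[of "p i"] this]
    show "((\<lambda>u. p i + integral {0..u} (\<lambda>s. f i (at_time x s))) has_real_derivative f i (at_time x t)) (at t within {0..\<tau>})"
      by simp
    show "p i + integral {0..u} (\<lambda>s. f i (at_time x s)) = at_time x u i" if "u \<in> {0..\<tau>}" for u
    proof -
      have "clip u = u" using that by (simp add: clip_def)
      then show ?thesis using i by (simp add: flow I_def)
    qed
  qed
  moreover have "at_time x 0 i = p i" if "i < n" for i
    using that \<open>\<tau> > 0\<close> by (simp add: flow I_def clip_def)
  ultimately show ?thesis using \<open>\<tau> > 0\<close> near[OF x(1)] by blast
qed

section \<open>Infinite fibres for fewer functions than variables\<close>

lemma meval_cong:
  assumes "mvars g \<subseteq> {..<n}" "\<And>i. i < n \<Longrightarrow> x i = y i"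
  shows "meval g x = meval g y"
  unfolding meval_def
  by (intro sum.cong arg_cong2[of _ _ _ _ "(*)"] prod.cong refl) (use assms in \<open>force simp: mvars_def\<close>)

lemma polynomial_flow:
  assumes v: "\<And>i. mvars (v i) \<subseteq> {..<n}" and "\<rho> > 0"
  shows "\<exists>\<tau>>0. \<exists>x. \<forall>i<n. x 0 i = p i \<and> (\<forall>t\<in>{0..\<tau>}. \<bar>x t i - p i\<bar> \<le> \<rho> \<and>
           ((\<lambda>s. x s i) has_real_derivative meval (v i) (x t)) (at t within {0..\<tau>}))"
proof -
  define R where "R = (\<Sum>i<n. \<bar>p i\<bar>) + \<rho>"
  have R: "\<bar>y i\<bar> \<le> R" if "\<bar>y i - p i\<bar> \<le> \<rho>" "i < n" for y i
    using that member_le_sum[of i "{..<n}" "\<lambda>i. \<bar>p i\<bar>"] by (simp add: R_def)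
  have "\<forall>i. \<exists>M L. tame_on_box n R (meval (v i)) M L" using meval_tame_on_box[OF v] by blast
  then obtain M L where tame: "\<And>i. tame_on_box n R (meval (v i)) (M i) (L i)"
    unfolding choice_iff by blast
  have nonneg: "0 \<le> M i" "0 \<le> L i" for i using tame_on_box_nonneg[OF tame[of i]] by auto
  show ?thesis
  proof (rule local_flow[OF \<open>\<rho> > 0\<close>, of "sum M {..<n}" "sum L {..<n}"])
    show "0 \<le> sum M {..<n}" "0 \<le> sum L {..<n}" using nonneg by (auto intro: sum_nonneg)
    show "\<bar>meval (v i) x\<bar> \<le> sum M {..<n}" if "i < n" "\<And>j. j < n \<Longrightarrow> \<bar>x j - p j\<bar> \<le> \<rho>" for i x
    proof -
      have "\<bar>meval (v i) x\<bar> \<le> M i" by (intro tame_on_boxD(1)[OF tame] R that(2))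
      also have "\<dots> \<le> sum M {..<n}" using nonneg that(1) by (intro member_le_sum) auto
      finally show ?thesis .
    qed
    show "\<bar>meval (v i) x - meval (v i) y\<bar> \<le> sum L {..<n} * \<delta>"
      if "i < n" "\<And>j. j < n \<Longrightarrow> \<bar>x j - p j\<bar> \<le> \<rho>" "\<And>j. j < n \<Longrightarrow> \<bar>y j - p j\<bar> \<le> \<rho>" "0 \<le> \<delta>"
        "\<And>j. j < n \<Longrightarrow> \<bar>x j - y j\<bar> \<le> \<delta>" for i x y \<delta>
    proof -
      have "\<bar>meval (v i) x - meval (v i) y\<bar> \<le> L i * \<delta>"
        by (intro tame_on_boxD(2)[OF tame] R that(2-5))
      also have "\<dots> \<le> sum L {..<n} * \<delta>"
        using nonneg that by (intro mult_right_mono member_le_sum) auto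
      finally show ?thesis .
    qed
  qed
qed

text \<open>
  The derivative of \<open>e j / e j0\<close> along a vector field \<open>v\<close> vanishes if \<open>\<Sum>i<n. W j i * v i = 0\<close>, where
  \<open>W j i\<close> is the numerator of the partial derivative. These are fewer equations than unknowns, so they
  have a nonzero solution with polynomial entries. Start its flow at a positive point outside the given
  algebraic set where \<open>v\<close> is not zero: the quotients stay constant, while some coordinate
  moves and hence takes infinitely many values.
\<close>

lemma not_generically_finite_to_one_if_few:
  assumes J: "finite J" "card J < n"
    and vars: "\<And>j. j \<in> insert j0 J \<Longrightarrow> mvars (e j) \<subseteq> {..<n}"
    and pos: "\<And>p. p \<in> pos_space n \<Longrightarrow> meval (e j0) p \<noteq> 0"
  shows "\<not> generically_finite_to_one n (\<lambda>p. \<lambda>j\<in>J. meval (e j) p / meval (e j0) p)"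
proof
  assume "generically_finite_to_one n (\<lambda>p. \<lambda>j\<in>J. meval (e j) p / meval (e j0) p)"
  then obtain A where A: "algebraic_subset n A" "A \<noteq> real_space n"
    and fin: "\<And>p. p \<in> pos_space n - A \<Longrightarrow> finite {q \<in> pos_space n.
      (\<lambda>j\<in>J. meval (e j) q / meval (e j0) q) = (\<lambda>j\<in>J. meval (e j) p / meval (e j0) p)}"
    unfolding generically_finite_to_one_def by blast
  obtain S where S: "\<forall>g\<in>S. mvars g \<subseteq> {..<n}" "A = {x \<in> real_space n. \<forall>g\<in>S. meval g x = 0}"
    using A(1) unfolding algebraic_subset_def by blast
  obtain g x0 where g: "g \<in> S" "meval g x0 \<noteq> 0" using A(2) S(2) by blast
  then have "g \<noteq> 0" by (auto simp: meval_eq_aeval)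
  have "\<forall>j. \<exists>d. j \<in> insert j0 J \<longrightarrow> is_gradient n (e j) d" using is_gradient_exists[OF vars] by blast
  then obtain d where d: "\<And>j. j \<in> insert j0 J \<Longrightarrow> is_gradient n (e j) (d j)"
    unfolding choice_iff by blast
  define G where "G = {g. mvars g \<subseteq> {..<n}}"
  have G: "0 \<in> G" "1 \<in> G" by (simp_all add: G_def)
  have G_closed: "a + b \<in> G" "a * b \<in> G" "- a \<in> G" if "a \<in> G" "b \<in> G" for a b
    using that mvars_add[of a b] mvars_mult[of a b] by (auto simp: G_def)
  define W where "W j i = (if j \<in> J then e j0 * d j i + - (e j * d j0 i) else 0)" for j i
  have "W j i \<in> G" for j i
  proof (cases "j \<in> J")
    case True
    have "e j0 \<in> G" "e j \<in> G" "d j i \<in> G" "d j0 i \<in> G"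
      using True vars is_gradient_mvars[OF d] by (auto simp: G_def)
    then have "e j0 * d j i + - (e j * d j0 i) \<in> G" by (intro G_closed)
    then show ?thesis using True by (simp add: W_def)
  qed (use G in \<open>simp add: W_def\<close>)
  then have "\<exists>v. (\<forall>i. v i \<in> G) \<and> (\<exists>i\<in>{..<n}. v i \<noteq> 0) \<and> (\<forall>j\<in>J. (\<Sum>i<n. W j i * v i) = 0)"
    by (intro kernel_vector_in_subring J G G_closed) (use J in simp_all)
  then obtain v i0 where v: "\<And>i. v i \<in> G" "i0 < n" "v i0 \<noteq> 0"
    "\<And>j. j \<in> J \<Longrightarrow> (\<Sum>i<n. W j i * v i) = 0"
    by (metis lessThan_iff)
  have "mvars (g * v i0) \<subseteq> {..<n}" using mvars_mult[of g "v i0"] S(1) g(1) v(1)[of i0] by (auto simp: G_def)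
  moreover have "g * v i0 \<noteq> 0" using \<open>g \<noteq> 0\<close> v(3) by simp
  ultimately obtain p where p: "p \<in> pos_space n" "meval (g * v i0) p \<noteq> 0"
    using nonzero_mpoly_nonzero_at_positive_point by blast
  then have "meval g p \<noteq> 0" and vp: "meval (v i0) p \<noteq> 0" by (auto simp: meval_eq_aeval aeval_simps)
  then have "p \<notin> A" using g(1) S(2) by auto
  define F where "F = {q \<in> pos_space n.
      (\<lambda>j\<in>J. meval (e j) q / meval (e j0) q) = (\<lambda>j\<in>J. meval (e j) p / meval (e j0) p)}"
  have "finite F" using fin p(1) \<open>p \<notin> A\<close> by (simp add: F_def)
  define \<rho> where "\<rho> = Min (p ` {..<n}) / 2"
  have p_pos: "p i > 0" if "i < n" for i using p(1) that by (auto simp: pos_space_def PiE_def)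
  have "0 < Min (p ` {..<n})" using v(2) p_pos by (subst Min_gr_iff) auto
  then have "\<rho> > 0" by (simp add: \<rho>_def)
  have "\<rho> < p i" if "i < n" for i
  proof -
    have "2 * \<rho> \<le> p i" using that by (simp add: \<rho>_def)
    then show ?thesis using \<open>\<rho> > 0\<close> by simp
  qed
  obtain \<tau> x where "\<tau> > 0" and x0: "\<And>i. i < n \<Longrightarrow> x 0 i = p i"
    and x: "\<And>i t. i < n \<Longrightarrow> t \<in> {0..\<tau>} \<Longrightarrow> \<bar>x t i - p i\<bar> \<le> \<rho>"
      "\<And>i t. i < n \<Longrightarrow> t \<in> {0..\<tau>} \<Longrightarrow> ((\<lambda>s. x s i) has_real_derivative meval (v i) (x t)) (at t within {0..\<tau>})"
    using polynomial_flow[of v n \<rho> p] v(1) \<open>\<rho> > 0\<close> unfolding G_def by blast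
  define q where "q t = restrict (x t) {..<n}" for t
  have q_pos: "q t \<in> pos_space n" if "t \<in> {0..\<tau>}" for t
  proof -
    have "x t i > 0" if "i < n" for i
      using x(1)[OF that \<open>t \<in> {0..\<tau>}\<close>] \<open>\<And>i. i < n \<Longrightarrow> \<rho> < p i\<close>[OF that] by linarith
    then show ?thesis by (auto simp: q_def pos_space_def)
  qed
  have q_eval: "meval (e j) (q t) = meval (e j) (x t)" if "j \<in> insert j0 J" for j t
    by (rule meval_cong[OF vars[OF that]]) (simp add: q_def)
  have "q t \<in> F" if t: "t \<in> {0..\<tau>}" for t
  proof -
    have ratio: "meval (e j) (q t) / meval (e j0) (q t) = meval (e j) p / meval (e j0) p" if j: "j \<in> J" for j
    proof -
      let ?r = "\<lambda>s. meval (e j) (x s) / meval (e j0) (x s)"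
      have "(?r has_real_derivative 0) (at s within {0..\<tau>})" if s: "s \<in> {0..\<tau>}" for s
      proof -
        have e: "((\<lambda>s. meval (e j') (x s)) has_real_derivative
            (\<Sum>i<n. meval (d j' i) (x s) * meval (v i) (x s))) (at s within {0..\<tau>})"
          if "j' \<in> insert j0 J" for j'
          by (rule is_gradientD[OF d[OF that]]) (rule x(2)[OF _ s])
        have nz: "meval (e j0) (x s) \<noteq> 0" using pos[OF q_pos[OF s]] q_eval[of j0 s] by simp
        have "0 = meval (\<Sum>i<n. W j i * v i) (x s)" using v(4)[OF j] by (simp add: meval_eq_aeval)
        also have "\<dots> = (\<Sum>i<n. meval (d j i) (x s) * meval (v i) (x s)) * meval (e j0) (x s) -
            meval (e j) (x s) * (\<Sum>i<n. meval (d j0 i) (x s) * meval (v i) (x s))"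
          using j by (simp add: W_def meval_eq_aeval aeval_simps algebra_simps sum_subtractf sum_distrib_left)
        finally show ?thesis
          using DERIV_divide[OF e e nz, of j] j by simp
      qed
      then obtain c where "\<forall>s\<in>{0..\<tau>}. ?r s = c"
        using has_field_derivative_zero_constant[of "{0..\<tau>}" ?r] by (auto simp: convex_real_interval)
      then have "?r t = ?r 0" using t by simp
      moreover have "meval (e j') (x 0) = meval (e j') p" if "j' \<in> insert j0 J" for j'
        by (rule meval_cong[OF vars[OF that]]) (simp add: x0)
      ultimately show ?thesis using q_eval j by simp
    qed
    show ?thesis unfolding F_def using q_pos[OF t] ratio by (auto intro!: restrict_ext)
  qed
  then have "(\<lambda>t. x t i0) ` {0..\<tau>} \<subseteq> (\<lambda>q. q i0) ` F"
    using v(2) by (intro image_subsetI image_eqI[of _ _ "q _"]) (auto simp: q_def)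
  then have "finite ((\<lambda>t. x t i0) ` {0..\<tau>})" using \<open>finite F\<close> finite_surj by blast
  moreover have "continuous_on {0..\<tau>} (\<lambda>t. x t i0)"
    using x(2)[OF v(2)] by (intro DERIV_continuous_on) auto
  ultimately have "(\<lambda>t. x t i0) constant_on {0..\<tau>}"
    by (intro continuous_finite_range_constant) auto
  then obtain c where c: "\<And>t. t \<in> {0..\<tau>} \<Longrightarrow> x t i0 = c" unfolding constant_on_def by blast
  have "((\<lambda>t. x t i0) has_real_derivative 0) (at 0 within {0..\<tau>})"
    by (rule has_field_derivative_transform_within[OF DERIV_const[of c] zero_less_one])
       (use c \<open>\<tau> > 0\<close> in auto)
  moreover have "((\<lambda>t. x t i0) has_real_derivative meval (v i0) (x 0)) (at 0 within {0..\<tau>})"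
    using x(2)[OF v(2), of 0] \<open>\<tau> > 0\<close> by simp
  ultimately have "meval (v i0) (x 0) = 0"
    using vector_derivative_unique_within_closed_interval[of 0 \<tau> 0] \<open>\<tau> > 0\<close>
    unfolding has_real_derivative_iff_has_vector_derivative by fastforce
  moreover have "meval (v i0) (x 0) = meval (v i0) p"
    using v(1) by (intro meval_cong[of _ n]) (auto simp: G_def x0)
  ultimately show False using vp by simp
qed

section \<open>Independence and positivity of the coefficients\<close>

definition coeffs_with_vars :: "nat set \<Rightarrow> mpoly poly \<Rightarrow> bool" where
  "coeffs_with_vars V f \<longleftrightarrow> (\<forall>i. mvars (coeff f i) \<subseteq> V)"

lemma coeffs_with_vars_add: "coeffs_with_vars V f \<Longrightarrow> coeffs_with_vars V g \<Longrightarrow> coeffs_with_vars V (f + g)"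
  unfolding coeffs_with_vars_def coeff_add using mvars_add by blast

lemma coeffs_with_vars_mult: "coeffs_with_vars V f \<Longrightarrow> coeffs_with_vars V g \<Longrightarrow> coeffs_with_vars V (f * g)"
  unfolding coeffs_with_vars_def coeff_mult using mvars_mult by (intro allI mvars_sum) blast

lemma mvars_rl_coefficient:
  assumes "k + num_params N \<le> n"
  shows "mvars (coord j (rl_equation T mvar k N)) \<subseteq> {..<n}"
proof -
  have "coeffs_with_vars {..<n} (fst (rl_equation T mvar k N)) \<and>
    coeffs_with_vars {..<n} (snd (rl_equation T mvar k N))"
    using assms
  proof (induction N arbitrary: k)
    case (Base c)
    then show ?case by (auto simp: coeffs_with_vars_def coeff_pCons split: nat.splits)
  next
    case (Series N1 N2)
    from Series.IH(1)[of k] Series.IH(2)[of "k + num_params N1"] Series.prems show ?case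
      by (simp add: series_def coeffs_with_vars_add coeffs_with_vars_mult)
  next
    case (Parallel N1 N2)
    from Parallel.IH(1)[of k] Parallel.IH(2)[of "k + num_params N1"] Parallel.prems show ?case
      by (simp add: series_def coeffs_with_vars_add coeffs_with_vars_mult)
  qed
  moreover obtain side i where "j = (side, i)" by fastforce
  ultimately show ?thesis by (cases side) (auto simp: coeffs_with_vars_def)
qed

text \<open>
  No cancellation occurs in the recursion for the equation, so its coefficients have nonnegative
  terms and are positive at positive points unless they are zero.
\<close>

definition nonneg_mpoly :: "mpoly \<Rightarrow> bool" where
  "nonneg_mpoly g \<longleftrightarrow> (\<forall>a. 0 \<le> Poly_Mapping.lookup g a)"

lemma nonneg_mpoly_add: "nonneg_mpoly g \<Longrightarrow> nonneg_mpoly h \<Longrightarrow> nonneg_mpoly (g + h)"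
  by (simp add: nonneg_mpoly_def lookup_add)

lemma nonneg_mpoly_mult: "nonneg_mpoly g \<Longrightarrow> nonneg_mpoly h \<Longrightarrow> nonneg_mpoly (g * h)"
  by (auto simp: mult_eq_sum_singles nonneg_mpoly_def lookup_sum lookup_single when_def intro!: sum_nonneg)

lemma nonneg_mpoly_sum: "(\<And>s. s \<in> S \<Longrightarrow> nonneg_mpoly (f s)) \<Longrightarrow> nonneg_mpoly (sum f S)"
  by (auto simp: nonneg_mpoly_def lookup_sum intro!: sum_nonneg)

lemma nonneg_mpoly_positive:
  assumes "nonneg_mpoly g" "g \<noteq> 0" "mvars g \<subseteq> {..<n}" "\<And>i. i < n \<Longrightarrow> p i > 0"
  shows "meval g p > 0"
  unfolding meval_def
proof (rule sum_pos)
  show "Poly_Mapping.keys g \<noteq> {}" using assms(2) by simp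
  fix a assume a: "a \<in> Poly_Mapping.keys g"
  then have "Poly_Mapping.lookup g a > 0"
    using assms(1) by (simp add: nonneg_mpoly_def in_keys_iff order_less_le)
  moreover have "p i > 0" if "i \<in> Poly_Mapping.keys a" for i
    using a that assms(3,4) by (auto simp: mvars_def)
  ultimately show "0 < Poly_Mapping.lookup g a * (\<Prod>i\<in>Poly_Mapping.keys a. p i ^ Poly_Mapping.lookup a i)"
    by (intro mult_pos_pos prod_pos zero_less_power)
qed simp

lemma nonneg_rl_coefficient: "nonneg_mpoly (coord j (rl_equation T mvar k N))"
proof -
  have "(\<forall>i. nonneg_mpoly (coeff (fst (rl_equation T mvar k N)) i)) \<and>
    (\<forall>i. nonneg_mpoly (coeff (snd (rl_equation T mvar k N)) i))"
  proof (induction N arbitrary: k)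
    case (Base c)
    have "nonneg_mpoly 0" "nonneg_mpoly 1" "nonneg_mpoly (mvar k)"
      by (auto simp: nonneg_mpoly_def mvar_def lookup_single when_def single_one[symmetric] simp del: single_one)
    then show ?case by (auto simp: coeff_pCons split: nat.splits)
  qed (auto simp: series_def coeff_mult intro!: nonneg_mpoly_add nonneg_mpoly_sum nonneg_mpoly_mult)
  moreover obtain side i where "j = (side, i)" by fastforce
  ultimately show ?thesis by (cases side) auto
qed

text \<open>
  By density a relation between the coefficients of the equation holds for arbitrary numbers in
  their place. Inserting \<open>1\<close> for \<open>j0\<close> and the Kronecker powers of \<open>t\<close> for \<open>J\<close> shows that it is trivial.
\<close>

lemma rl_coefficients_independent:
  fixes T N
  defines "e \<equiv> \<lambda>j. coord j (rl_equation T mvar 0 N)"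
  assumes J: "finite J" "insert j0 J \<subseteq> positions (rl_bounds T N)" "j0 \<notin> J"
  shows "homogeneously_independent e J j0"
  unfolding homogeneously_independent_def
proof (intro allI impI)
  fix D :: nat and \<alpha> :: "(side \<times> nat \<Rightarrow> nat) \<Rightarrow> real"
  let ?B = "J \<rightarrow>\<^sub>E {..D}"
  assume zero: "(\<Sum>b\<in>?B. Poly_Mapping.single 0 (\<alpha> b) * homogeneous_monomial e J j0 D b) = 0"
  have fin: "finite ?B" using J(1) by (simp add: finite_PiE)
  define Q where "Q s = (\<Sum>b\<in>?B. complex_of_real (\<alpha> b) * homogeneous_monomial (\<lambda>j. coord j s) J j0 D b)" for s
  have "polyfun Q"
    unfolding Q_def homogeneous_monomial_def
    by (intro polyfun_sum polyfun_mult polyfun_const polyfun_power polyfun_prod polyfun_coord)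
  have "Q (scale c (rl_equation T x 0 N)) = 0" for c x
  proof -
    have "homogeneous_monomial (\<lambda>j. coord j (scale c (rl_equation T x 0 N))) J j0 D b =
        c ^ (card J * D) * aeval x (homogeneous_monomial e J j0 D b)" if "b \<in> ?B" for b
      using aeval_coord_rl_equation[where x = x and v = mvar and k = 0 and T = T and N = N]
      by (simp add: homogeneous_monomial_scale[OF that] aeval_homogeneous_monomial e_def)
    then have "Q (scale c (rl_equation T x 0 N)) =
        c ^ (card J * D) * aeval x (\<Sum>b\<in>?B. Poly_Mapping.single 0 (\<alpha> b) * homogeneous_monomial e J j0 D b)"
      by (simp add: Q_def aeval_simps sum_distrib_left mult_ac)
    then show ?thesis by (simp add: zero)
  qed
  then have Q0: "Q s = 0" if "s \<in> pair_box (rl_bounds T N)" for s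
    using cone_dense[of T N] \<open>polyfun Q\<close> that unfolding cone_dense_def by blast
  obtain w :: "side \<times> nat \<Rightarrow> nat" where w: "inj_on (\<lambda>b. \<Sum>j\<in>J. w j * b j) ?B"
    using kronecker_weights[OF J(1)] by blast
  have "(\<Sum>b\<in>?B. complex_of_real (\<alpha> b) * t ^ (\<Sum>j\<in>J. w j * b j)) = 0" for t
  proof -
    define y where "y j = (if j = j0 then 1 else if j \<in> J then t ^ w j else 0)" for j
    have y0: "finite {i. y (side, i) \<noteq> 0}" for side
    proof (rule finite_subset)
      show "{i. y (side, i) \<noteq> 0} \<subseteq> snd ` insert j0 J" by (force simp: y_def split: if_splits)
    qed (use J(1) in simp)
    have "\<exists>f. \<forall>i. coeff f i = y (side, i)" for side
    proof -
      obtain m where m: "{i. y (side, i) \<noteq> 0} \<subseteq> {..<m}" using y0[of side] finite_nat_iff_bounded by blast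
      have "coeff (\<Sum>k<m. monom (y (side, k)) k) i = y (side, i)" for i
        using m by (auto simp: coeff_sum)
      then show ?thesis by blast
    qed
    then obtain f g where fg: "\<And>i. coeff f i = y (Voltage, i)" "\<And>i. coeff g i = y (Current, i)" by metis
    have coord: "coord j (f, g) = y j" for j
      by (cases "(j, (f, g))" rule: coord.cases) (auto simp: fg)
    have "(f, g) \<in> pair_box (rl_bounds T N)"
      unfolding pair_box_iff coord using J(2) by (auto simp: y_def split: if_splits)
    then have "Q (f, g) = 0" by (rule Q0)
    moreover have "homogeneous_monomial (\<lambda>j. coord j (f, g)) J j0 D b = t ^ (\<Sum>j\<in>J. w j * b j)" for b
    proof -
      have "(\<Prod>j\<in>J. y j ^ b j) = (\<Prod>j\<in>J. t ^ (w j * b j))"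
        using J(3) by (intro prod.cong) (auto simp: y_def power_mult)
      then show ?thesis by (simp add: homogeneous_monomial_def coord power_sum) (simp add: y_def)
    qed
    ultimately show ?thesis by (simp add: Q_def)
  qed
  then have "complex_of_real (\<alpha> b) = 0" if "b \<in> ?B" for b
    by (intro sum_powers_eq_0[OF fin w _ that]) (simp add: infinite_UNIV_char_0)
  then show "\<forall>b\<in>?B. \<alpha> b = 0" by simp
qed

theorem theorem1p1:
  fixes N :: network and j0 :: "side \<times> nat"
  assumes two_types: "components N \<subseteq> {Inductor, Capacitor} \<or>
      components N \<subseteq> {Inductor, Resistor} \<or>
      components N \<subseteq> {Capacitor, Resistor}"
    and normalizer: "j0 \<in> nonzero_coeffs N"
  shows "locally_identifiable N j0 \<longleftrightarrow> card (non_monic_coeffs N j0) = num_params N"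
proof -
  obtain T \<pi> where \<pi>: "bij_betw \<pi> (nonzero_coeffs N) {j. coord j (rl_equation T mvar 0 N) \<noteq> 0}"
    "\<And>j. j \<in> nonzero_coeffs N \<Longrightarrow> coord (\<pi> j) (rl_equation T mvar 0 N) = eq_coeff N j"
    using two_types_coefficients[OF two_types] by blast
  define n where "n = num_params N"
  define e where "e j = coord j (rl_equation T mvar 0 N)" for j
  define P where "P = positions (rl_bounds T N)"
  define J where "J = \<pi> ` non_monic_coeffs N j0"
  have "{j. e j \<noteq> 0} = P"
    using rl_coefficients_nonzero_iff by (auto simp: e_def P_def)
  with \<pi>(1) have bij: "bij_betw \<pi> (nonzero_coeffs N) P" by (simp add: e_def)
  then have inj: "inj_on \<pi> (nonzero_coeffs N)" by (rule bij_betw_imp_inj_on)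
  have inj': "inj_on \<pi> (non_monic_coeffs N j0)"
    using inj by (rule inj_on_subset) (auto simp: non_monic_coeffs_def)
  have J: "J = P - {\<pi> j0}" and \<pi>j0: "\<pi> j0 \<in> P"
    using bij normalizer inj unfolding J_def non_monic_coeffs_def bij_betw_def
    by (auto dest: inj_onD)
  have "finite P" by (simp add: P_def)
  then have finJ: "finite J" by (simp add: J)
  have card_J: "card J = card (non_monic_coeffs N j0)"
    unfolding J_def by (rule card_image[OF inj'])
  have "card J \<le> n"
    using J \<pi>j0 \<open>finite P\<close> card_positions[OF admissible_rl_bounds, of T N] num_positions_le[of T N]
    by (simp add: P_def n_def)
  have vars: "mvars (e j) \<subseteq> {..<n}" for j
    unfolding e_def n_def by (rule mvars_rl_coefficient) simp
  have pos: "meval (e (\<pi> j0)) p \<noteq> 0" if "p \<in> pos_space n" for p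
  proof -
    have "e (\<pi> j0) \<noteq> 0" using \<pi>j0 \<open>{j. e j \<noteq> 0} = P\<close> by blast
    moreover have "p i > 0" if "i < n" for i
      using \<open>p \<in> pos_space n\<close> that by (auto simp: pos_space_def)
    ultimately have "meval (e (\<pi> j0)) p > 0"
      using nonneg_mpoly_positive[OF _ _ vars] nonneg_rl_coefficient unfolding e_def
      by blast
    then show ?thesis by simp
  qed
  let ?c = "\<lambda>p. \<lambda>j\<in>J. meval (e j) p / meval (e (\<pi> j0)) p"
  have same_fibres: "coeff_map N j0 q = coeff_map N j0 p \<longleftrightarrow> ?c q = ?c p" for p q
  proof -
    have restrict_eq: "restrict f S = restrict g S \<longleftrightarrow> (\<forall>j\<in>S. f j = g j)"
      for f g :: "side \<times> nat \<Rightarrow> real" and S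
      by (metis restrict_apply' restrict_ext)
    have "j \<in> nonzero_coeffs N" if "j \<in> non_monic_coeffs N j0" for j
      using that by (simp add: non_monic_coeffs_def)
    then show ?thesis
      unfolding coeff_map_def restrict_eq J_def using \<pi>(2) normalizer by (simp add: e_def)
  qed
  have "locally_identifiable N j0 \<longleftrightarrow> generically_finite_to_one n ?c"
    unfolding locally_identifiable_def generically_finite_to_one_def same_fibres n_def by (rule refl)
  also have "\<dots> \<longleftrightarrow> card J = n"
  proof
    assume "card J = n"
    moreover have "homogeneously_independent e J (\<pi> j0)"
      unfolding e_def using J \<pi>j0 finJ by (intro rl_coefficients_independent) (auto simp: P_def)
    ultimately show "generically_finite_to_one n ?c"
      using finJ vars pos by (intro generically_finite_to_one_if_independent) auto
  next
    assume finite_to_one: "generically_finite_to_one n ?c"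
    have "\<not> card J < n"
    proof
      assume "card J < n"
      then have "\<not> generically_finite_to_one n ?c"
        using finJ vars pos by (intro not_generically_finite_to_one_if_few)
      with finite_to_one show False by simp
    qed
    with \<open>card J \<le> n\<close> show "card J = n" by simp
  qed
  finally show ?thesis by (simp add: card_J n_def)
qed

end
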